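(* Let $(c,\kappa)\in\tilde{\mathcal{D}}\cup\mathcal{C}$. Assume that $u\in\mathcal{X}(\mathbb{R})$ is a weak solution to $\mathrm{TW}(c,\kappa)$ and let $\eta=1-|u|^2$. Suppose that $\operatorname{card}(\Gamma(u))\ge2$ and that there exists $x_0\in\mathcal{Z}(u)$, and consider its closest singular points $$\mathfrak{a}^0=\sup\{x<x_0: x\in\Gamma(u)\},\qquad \mathfrak{b}^0=\inf\{x>x_0: x\in\Gamma(u)\}.$$ Then $\mathfrak{a}^0=2x_0-\mathfrak{b}^0$ and $\eta(x)=\eta(2x_0-x)$ for all $x\in(\mathfrak{a}^0,x_0)$. Moreover, if $0<|u(x_0)|^2<1/(2\kappa)$, then $\eta'<0$ in $(x_0,\mathfrak{b}^0)$, while if $|u(x_0)|^2>1/(2\kappa)$, then $\eta'>0$ in $(x_0,\mathfrak{b}^0)$.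
   Context: For $z_1,z_2\in\mathbb{C}$, $\langle z_1,z_2\rangle=\operatorname{Re}(z_1\overline{z_2})$. Energy space: $\mathcal{X}(\mathbb{R})=\{v\in H^1_{\mathrm{loc}}(\mathbb{R};\mathbb{C}): 1-|v|^2\in L^2(\mathbb{R}),\ v'\in L^2(\mathbb{R})\}$ (its elements are continuous). $\mathrm{TW}(c,\kappa)$ is the equation $icu'+u''+u(1-|u|^2)+\kappa u(1-|u|^2)''=0$. A function $u\in\mathcal{X}(\mathbb{R})$ is a weak solution if for all $\phi\in C_0^\infty(\mathbb{R};\mathbb{C})$, $$\int_{\mathbb{R}}\langle icu'+u(1-|u|^2),\phi\rangle-\langle u',\phi'\rangle+2\kappa\langle u,u'\rangle\langle u,\phi\rangle'=0.$$ $\Gamma(u)=\{x\in\mathbb{R}:|u(x)|^2=1/(2\kappa)\}$, and $\mathcal{Z}(u)=\{x\in\mathbb{R}\setminus\Gamma(u): x\text{ is a local extremum of }1-|u|^2\}$. Under the hypotheses of the claim, points of $\Gamma(u)$ exist on both sides of any $x_0\in\mathcal{Z}(u)$, so $\mathfrak{a}^0,\mathfrak{b}^0$ are real numbers; $u$ is smooth on $(\mathfrak{a}^0,\mathfrak{b}^0)$. Parameter sets: $\tilde{\mathcal{D}}=\mathcal{D}_1\cup\mathcal{D}_3\cup\mathcal{B}_-\cup\mathcal{B}_+$ with $\mathcal{D}_1=\{0\le c<\sqrt2,\ 0<\kappa<1/2\}$, $\mathcal{D}_3=\{c>\sqrt2,\ \kappa>1/2\}$, $\mathcal{B}_-=\{c=\sqrt2,\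 0<\kappa<1/2\}$, $\mathcal{B}_+=\{c=\sqrt2,\ \kappa>1/2\}$; and $\mathcal{C}=\{c\ge0,\ \kappa=1/2\}$. *)

theory Defs
  imports "HOL-Analysis.Analysis"
begin

definition smooth :: "(real \<Rightarrow> 'a::real_normed_vector) \<Rightarrow> bool" where
  "smooth f \<longleftrightarrow>
     (\<forall>n x. ((\<lambda>g y. vector_derivative g (at y)) ^^ n) f differentiable (at x))"

definition test_function :: "(real \<Rightarrow> 'a::real_normed_vector) \<Rightarrow> bool" where
  "test_function \<phi> \<longleftrightarrow> smooth \<phi> \<and> compact (closure {x. \<phi> x \<noteq> 0})"

definition L1_loc :: "(real \<Rightarrow> 'a::euclidean_space) set" where
  "L1_loc = {f. f \<in> borel_measurable lebesgue \<and>
                (\<forall>K. compact K \<longrightarrow> set_integrable lebesgue K f)}"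

definition L2 :: "(real \<Rightarrow> 'a::euclidean_space) set" where
  "L2 = {f. f \<in> borel_measurable lebesgue \<and> integrable lebesgue (\<lambda>x. (norm (f x))\<^sup>2)}"

definition L2_loc :: "(real \<Rightarrow> 'a::euclidean_space) set" where
  "L2_loc = {f. f \<in> borel_measurable lebesgue \<and>
                (\<forall>K. compact K \<longrightarrow> set_integrable lebesgue K (\<lambda>x. (norm (f x))\<^sup>2))}"

definition has_weak_deriv ::
    "(real \<Rightarrow> 'a::euclidean_space) \<Rightarrow> (real \<Rightarrow> 'a) \<Rightarrow> bool" where
  "has_weak_deriv v w \<longleftrightarrow> v \<in> L1_loc \<and> w \<in> L1_loc \<and>
     (\<forall>\<phi> :: real \<Rightarrow> real. test_function \<phi> \<longrightarrow>
        (LINT x|lebesgue. deriv \<phi> x *\<^sub>R v x) = - (LINT x|lebesgue. \<phi> x *\<^sub>R w x))"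

text \<open>
  A weak derivative is unique up to a null set. The operator below picks one representative;
  it is only used inside Lebesgue integrals and in square-integrability conditions, neither of
  which depends on the choice. It is meaningful only for functions that have a weak derivative.
\<close>

definition wderiv :: "(real \<Rightarrow> 'a::euclidean_space) \<Rightarrow> real \<Rightarrow> 'a" where
  "wderiv v = (SOME w. has_weak_deriv v w)"

definition H1_loc :: "(real \<Rightarrow> 'a::euclidean_space) set" where
  "H1_loc = {v. v \<in> L2_loc \<and> (\<exists>w. has_weak_deriv v w) \<and> wderiv v \<in> L2_loc}"

definition eta :: "(real \<Rightarrow> complex) \<Rightarrow> real \<Rightarrow> real" where
  "eta u x = 1 - (cmod (u x))\<^sup>2"

text \<open>
  Every class in the Sobolev space \<^term>\<open>H1_loc\<close> has a unique continuous representative; elements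
  of the energy space are identified with that representative, so that their point values make
  sense.
\<close>

definition energy_space :: "(real \<Rightarrow> complex) set" where
  "energy_space = {v. continuous_on UNIV v \<and> v \<in> H1_loc \<and> eta v \<in> L2 \<and> wderiv v \<in> L2}"

text \<open>
  The inner product of the library on the complex numbers is
  \<open>z\<^sub>1 \<bullet> z\<^sub>2 = Re (z\<^sub>1 * cnj z\<^sub>2)\<close>.
\<close>

definition weak_solution_TW :: "real \<Rightarrow> real \<Rightarrow> (real \<Rightarrow> complex) \<Rightarrow> bool" where
  "weak_solution_TW c \<kappa> u \<longleftrightarrow> u \<in> energy_space \<and>
     (\<forall>\<phi> :: real \<Rightarrow> complex. test_function \<phi> \<longrightarrow>
        (LINT x|lebesgue.
            (\<i> * of_real c * wderiv u x + u x * of_real (1 - (cmod (u x))\<^sup>2)) \<bullet> \<phi> x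
          - wderiv u x \<bullet> vector_derivative \<phi> (at x)
          + 2 * \<kappa> * (u x \<bullet> wderiv u x) * wderiv (\<lambda>y. u y \<bullet> \<phi> y) x) = 0)"

definition singular_set :: "real \<Rightarrow> (real \<Rightarrow> complex) \<Rightarrow> real set" where
  "singular_set \<kappa> u = {x. (cmod (u x))\<^sup>2 = 1 / (2 * \<kappa>)}"

definition local_extremum :: "(real \<Rightarrow> real) \<Rightarrow> real \<Rightarrow> bool" where
  "local_extremum f x \<longleftrightarrow>
     (\<forall>\<^sub>F y in nhds x. f y \<le> f x) \<or> (\<forall>\<^sub>F y in nhds x. f x \<le> f y)"

definition regular_extrema :: "real \<Rightarrow> (real \<Rightarrow> complex) \<Rightarrow> real set" where
  "regular_extrema \<kappa> u = {x. x \<notin> singular_set \<kappa> u \<and> local_extremum (eta u) x}"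

definition D1 :: "(real \<times> real) set" where
  "D1 = {(c, \<kappa>). 0 \<le> c \<and> c < sqrt 2 \<and> 0 < \<kappa> \<and> \<kappa> < 1/2}"

definition D3 :: "(real \<times> real) set" where
  "D3 = {(c, \<kappa>). c > sqrt 2 \<and> \<kappa> > 1/2}"

definition B_minus :: "(real \<times> real) set" where
  "B_minus = {(c, \<kappa>). c = sqrt 2 \<and> 0 < \<kappa> \<and> \<kappa> < 1/2}"

definition B_plus :: "(real \<times> real) set" where
  "B_plus = {(c, \<kappa>). c = sqrt 2 \<and> \<kappa> > 1/2}"

definition D_tilde :: "(real \<times> real) set" where
  "D_tilde = D1 \<union> D3 \<union> B_minus \<union> B_plus"

definition C_set :: "(real \<times> real) set" where
  "C_set = {(c, \<kappa>). c \<ge> 0 \<and> \<kappa> = 1/2}"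

end

theory Submission
  imports Defs "HOL-Computational_Algebra.Polynomial"
begin

text \<open>
  Write \<open>p\<close> for the weak derivative of \<open>u\<close>. The weak equation says that
  \<open>W = p - 2 \<kappa> (u \<bullet> p) u\<close> has a locally integrable weak derivative, so \<open>W\<close> is continuous up to
  a null set. Off the singular set the linear map \<open>p \<mapsto> W\<close> is invertible, hence \<open>p\<close> is continuous
  there, and a second pass makes \<open>u\<close> twice differentiable. Pairing the equation with \<open>\<i> * u\<close>
  and with \<open>u'\<close> gives two first integrals on every interval free of singular points; eliminating
  them from the pairing with \<open>u\<close> leaves a scalar equation for \<open>\<eta>\<close>,
  \<open>(1 - 2 \<kappa> + 2 \<kappa> \<eta>) \<eta>'' + \<kappa> (\<eta>')\<^sup>2 + 3 \<eta>\<^sup>2 + (c\<^sup>2 - 2) \<eta> + m = 0\<close>, which is invariant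
  under reflection and has unique solutions away from the singular set.

  Consequently \<open>\<eta>\<close> is even about every critical point, as long as no singular point is met.
  Reflecting the singular point nearest to \<open>x\<^sub>0\<close> produces the other endpoint. A second critical
  point strictly between \<open>x\<^sub>0\<close> and \<open>\<bb>\<^sup>0\<close> would reflect \<open>\<bb>\<^sup>0\<close> to a singular point inside
  \<open>(\<aa>\<^sup>0, \<bb>\<^sup>0)\<close>, so \<open>\<eta>'\<close> has a constant sign, which is read off from the values at the ends.
\<close>

section \<open>Smooth functions of one real variable\<close>

text \<open>Smoothness asks for all iterates of the derivative. A class of functions in which every
  member has a derivative that is again a member contains all these iterates, so none of them has to
  be computed.\<close>

lemma smooth_coinduct:
  fixes f :: "real \<Rightarrow> 'a::real_normed_vector"
  assumes "P f"
    and step: "\<And>f. P f \<Longrightarrow> \<exists>g. P g \<and> (\<forall>x. (f has_vector_derivative g x) (at x))"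
  shows "smooth f"
  unfolding smooth_def
proof (intro allI)
  fix n x
  \<comment> \<open>Uniqueness of derivatives identifies the member \<open>g\<close> supplied by
    \<open>step\<close> with the operator that \<open>smooth\<close> iterates.\<close>
  have D: "\<exists>g. P g \<and> (\<forall>x. (f has_vector_derivative g x) (at x)) \<and> (\<lambda>y. vector_derivative f (at y)) = g"
    if "P f" for f
    using step[OF that] by (metis (no_types, lifting) ext vector_derivative_at)
  have "P (((\<lambda>g y. vector_derivative g (at y)) ^^ n) f)"
  proof (induction n)
    case (Suc n)
    then show ?case using D by (metis (no_types, lifting) comp_apply funpow.simps(2))
  qed (simp add: assms(1))
  then show "((\<lambda>g y. vector_derivative g (at y)) ^^ n) f differentiable at x"
    using step by (meson differentiableI_vector)
qed

lemma smooth_has_vector_derivative: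
  assumes "smooth f"
  shows "(f has_vector_derivative vector_derivative f (at x)) (at x)"
  using assms[unfolded smooth_def, rule_format, of 0 x] by (simp add: vector_derivative_works)

lemma smooth_vector_derivative:
  assumes "smooth f"
  shows "smooth (\<lambda>y. vector_derivative f (at y))"
  unfolding smooth_def
proof (intro allI)
  fix n x
  show "((\<lambda>g y. vector_derivative g (at y)) ^^ n) (\<lambda>y. vector_derivative f (at y)) differentiable at x"
    using assms[unfolded smooth_def, rule_format, of "Suc n" x]
    by (simp only: funpow_Suc_right o_apply)
qed

lemma smooth_continuous_on: "smooth f \<Longrightarrow> continuous_on S f"
  by (meson continuous_at_imp_continuous_on has_vector_derivative_continuous smooth_has_vector_derivative)

text \<open>Bridge between the \<open>vector_derivative\<close> in \<open>smooth\<close> and the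
  \<open>deriv\<close> in \<open>has_weak_deriv\<close>.\<close>

lemma smooth_deriv_real:
  fixes f :: "real \<Rightarrow> real"
  assumes "smooth f"
  shows "(f has_real_derivative deriv f x) (at x)" "smooth (deriv f)"
proof -
  have *: "(f has_real_derivative vector_derivative f (at x)) (at x)" for x
    using smooth_has_vector_derivative[OF assms]
    by (simp add: has_real_derivative_iff_has_vector_derivative)
  then have "deriv f = (\<lambda>y. vector_derivative f (at y))"
    by (auto intro!: ext DERIV_imp_deriv)
  then show "(f has_real_derivative deriv f x) (at x)" "smooth (deriv f)"
    using * smooth_vector_derivative[OF assms] by auto
qed

lemma smooth_primitive:
  assumes "smooth f" "\<And>x. (F has_vector_derivative f x) (at x)"
  shows "smooth F"
\<comment> \<open>One differentiation leads from \<open>F\<close> to the smooth \<open>f\<close>,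
  and smooth functions stay smooth, so adding the single function \<open>F\<close> keeps the class
  closed.\<close>
proof (rule smooth_coinduct[where P = "\<lambda>h. h = F \<or> smooth h"])
  fix h assume "h = F \<or> smooth h"
  then show "\<exists>g. (g = F \<or> smooth g) \<and> (\<forall>x. (h has_vector_derivative g x) (at x))"
  proof
    assume "h = F"
    then show ?thesis using assms by (intro exI[of _ f]) simp
  next
    assume h: "smooth h"
    show ?thesis
      by (intro exI[of _ "\<lambda>y. vector_derivative h (at y)"] conjI allI disjI2)
        (rule smooth_vector_derivative[OF h], rule smooth_has_vector_derivative[OF h])
  qed
qed simp

lemma smooth_const: "smooth (\<lambda>_. c)"
  by (rule smooth_coinduct[where P = "\<lambda>h. \<exists>c. h = (\<lambda>_. c)"])
    (auto intro: derivative_eq_intros)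

lemma smooth_scaleR_const:
  fixes f :: "real \<Rightarrow> real"
  assumes "smooth f"
  shows "smooth (\<lambda>x. f x *\<^sub>R e)"
proof (rule smooth_coinduct[where P = "\<lambda>h. \<exists>f. smooth f \<and> h = (\<lambda>x. f x *\<^sub>R e)"])
  fix h assume "\<exists>f. smooth f \<and> h = (\<lambda>x. f x *\<^sub>R e)"
  then obtain f :: "real \<Rightarrow> real" where f: "smooth f" "h = (\<lambda>x. f x *\<^sub>R e)" by blast
  have "(h has_vector_derivative deriv f x *\<^sub>R e) (at x)" for x
    unfolding f(2) using smooth_deriv_real(1)[OF f(1)]
    by (auto intro!: derivative_eq_intros)
  then show "\<exists>g. (\<exists>f. smooth f \<and> g = (\<lambda>x. f x *\<^sub>R e)) \<and> (\<forall>x. (h has_vector_derivative g x) (at x))"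
    using smooth_deriv_real(2)[OF f(1)] by blast
qed (use assms in blast)

text \<open>The non-unital algebra generated by \<open>S\<close>. It serves as the invariant class
  for \<open>smooth_coinduct\<close>, which avoids a Leibniz formula for higher derivatives of
  products.\<close>

inductive_set generated_alg :: "(real \<Rightarrow> real) set \<Rightarrow> (real \<Rightarrow> real) set" for S where
  base: "f \<in> S \<Longrightarrow> f \<in> generated_alg S"
| add: "f \<in> generated_alg S \<Longrightarrow> g \<in> generated_alg S \<Longrightarrow> (\<lambda>x. f x + g x) \<in> generated_alg S"
| mult: "f \<in> generated_alg S \<Longrightarrow> g \<in> generated_alg S \<Longrightarrow> (\<lambda>x. f x * g x) \<in> generated_alg S"

text \<open>By the sum and product rules it is enough that the derivatives of the generators lie in
  the algebra; they need not be generators themselves.\<close>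

lemma smooth_generated_alg:
  assumes S: "\<And>f. f \<in> S \<Longrightarrow> \<exists>g\<in>generated_alg S. \<forall>x. (f has_real_derivative g x) (at x)"
    and "f \<in> generated_alg S"
  shows "smooth f"
proof (rule smooth_coinduct[where P = "\<lambda>f. f \<in> generated_alg S"])
  fix f assume "f \<in> generated_alg S"
  then show "\<exists>g. g \<in> generated_alg S \<and> (\<forall>x. (f has_vector_derivative g x) (at x))"
    unfolding has_real_derivative_iff_has_vector_derivative [symmetric]
  proof induction
    case (base f)
    then show ?case using S by blast
  next
    case (add f g)
    then obtain f' g' where "f' \<in> generated_alg S" "\<And>x. (f has_real_derivative f' x) (at x)"
      "g' \<in> generated_alg S" "\<And>x. (g has_real_derivative g' x) (at x)" by blast
    then show ?case
      by (intro exI[of _ "\<lambda>x. f' x + g' x"]) (auto intro: generated_alg.add derivative_intros)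
  next
    case (mult f g)
    then obtain f' g' where "f' \<in> generated_alg S" "\<And>x. (f has_real_derivative f' x) (at x)"
      "g' \<in> generated_alg S" "\<And>x. (g has_real_derivative g' x) (at x)" by blast
    with mult.hyps show ?case
      by (intro exI[of _ "\<lambda>x. f' x * g x + g' x * f x"])
        (auto intro: generated_alg.add generated_alg.mult DERIV_mult)
  qed
qed (rule assms)

lemma smooth_generated_alg_smooth: "f \<in> generated_alg {f. smooth f} \<Longrightarrow> smooth f"
proof (rule smooth_generated_alg)
  fix f :: "real \<Rightarrow> real" assume "f \<in> {f. smooth f}"
  then show "\<exists>g\<in>generated_alg {f. smooth f}. \<forall>x. (f has_real_derivative g x) (at x)"
    by (intro bexI[of _ "deriv f"]) (auto intro: generated_alg.base smooth_deriv_real)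
qed

lemma smooth_mult:
  fixes f g :: "real \<Rightarrow> real"
  shows "smooth f \<Longrightarrow> smooth g \<Longrightarrow> smooth (\<lambda>x. f x * g x)"
  by (intro smooth_generated_alg_smooth generated_alg.mult generated_alg.base) auto

lemma smooth_add:
  fixes f g :: "real \<Rightarrow> real"
  shows "smooth f \<Longrightarrow> smooth g \<Longrightarrow> smooth (\<lambda>x. f x + g x)"
  by (intro smooth_generated_alg_smooth generated_alg.add generated_alg.base) auto

text \<open>
  The family below is closed under differentiation, so the smoothness of
  \<open>exp (- 1 / x)\<close>, extended by \<open>0\<close> to \<open>x \<le> 0\<close>, reduces to a single derivative.
\<close>

definition flat :: "real poly \<Rightarrow> real \<Rightarrow> real" where
  "flat q x = (if x > 0 then poly q (1 / x) * exp (- (1 / x)) else 0)"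

lemma poly_exp_tendsto_0: "((\<lambda>y. poly q y * exp (- y)) \<longlongrightarrow> 0) at_top" for q :: "real poly"
proof -
  have "((\<lambda>y. \<Sum>i\<le>degree q. coeff q i * (y ^ i / exp y)) \<longlongrightarrow> (\<Sum>i\<le>degree q. coeff q i * 0)) at_top"
    by (intro tendsto_sum tendsto_mult tendsto_const tendsto_power_div_exp_0)
  moreover have "poly q y * exp (- y) = (\<Sum>i\<le>degree q. coeff q i * (y ^ i / exp y))" for y
    by (simp add: poly_altdef sum_distrib_right exp_minus divide_inverse mult.assoc)
  ultimately show ?thesis by simp
qed

text \<open>In the variable \<open>y = 1 / x\<close> one has \<open>d/dx = - y^2 d/dy\<close>, which
  sends \<open>q(y) exp(-y)\<close> to \<open>y^2 (q - q')(y) exp(-y)\<close>; the factor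
  \<open>[:0, 0, 1:]\<close> is \<open>y^2\<close>. At \<open>0\<close> the exponential decay beats
  every polynomial.\<close>

lemma flat_has_real_derivative:
  "(flat q has_real_derivative flat ([:0, 0, 1:] * (q - pderiv q)) x) (at x)"
proof (cases x "0::real" rule: linorder_cases)
  case less
  have "(flat q has_real_derivative 0) (at x)"
    by (rule has_field_derivative_transform_within_open[where f = "\<lambda>_. 0" and S = "{..<0}"])
      (use less in \<open>auto simp: flat_def\<close>)
  then show ?thesis using less by (simp add: flat_def)
next
  case greater
  have inv: "((\<lambda>x. 1 / x) has_real_derivative - (1 / x\<^sup>2)) (at x)"
    using greater by (auto intro!: derivative_eq_intros simp: power2_eq_square)
  have "((\<lambda>x. poly q (1 / x)) has_real_derivative poly (pderiv q) (1 / x) * - (1 / x\<^sup>2)) (at x)"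
    by (rule DERIV_chain2[OF poly_DERIV inv])
  moreover have "((\<lambda>x. exp (- (1 / x))) has_real_derivative exp (- (1 / x)) * - (- (1 / x\<^sup>2))) (at x)"
    by (rule DERIV_chain2[OF DERIV_exp DERIV_minus[OF inv]])
  ultimately have "((\<lambda>x. poly q (1 / x) * exp (- (1 / x))) has_real_derivative
      poly (pderiv q) (1 / x) * - (1 / x\<^sup>2) * exp (- (1 / x)) +
      exp (- (1 / x)) * - (- (1 / x\<^sup>2)) * poly q (1 / x)) (at x)"
    by (rule DERIV_mult)
  moreover have "poly (pderiv q) (1 / x) * - (1 / x\<^sup>2) * exp (- (1 / x)) +
      exp (- (1 / x)) * - (- (1 / x\<^sup>2)) * poly q (1 / x) = flat ([:0, 0, 1:] * (q - pderiv q)) x"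
    using greater by (simp add: flat_def power2_eq_square algebra_simps)
  ultimately have "((\<lambda>x. poly q (1 / x) * exp (- (1 / x))) has_real_derivative
      flat ([:0, 0, 1:] * (q - pderiv q)) x) (at x)"
    by (rule DERIV_cong)
  then show ?thesis
    by (rule has_field_derivative_transform_within_open[where S = "{0<..}"])
      (use greater in \<open>auto simp: flat_def\<close>)
next
  case equal
  \<comment> \<open>Dividing by \<open>h\<close> multiplies the polynomial in \<open>1 / h\<close>
    by its variable, hence \<open>pCons 0 q\<close>.\<close>
  have "((\<lambda>h. poly (pCons 0 q) (inverse h) * exp (- inverse h)) \<longlongrightarrow> 0) (at_right 0)"
    by (rule filterlim_compose[OF poly_exp_tendsto_0 filterlim_inverse_at_top_right])
  then have R: "((\<lambda>h. flat q h / h) \<longlongrightarrow> 0) (at_right 0)"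
    by (rule Lim_transform_eventually)
      (simp add: eventually_at_filter flat_def divide_inverse mult_ac)
  have L: "((\<lambda>h. flat q h / h) \<longlongrightarrow> 0) (at_left 0)"
    by (rule tendsto_eventually) (simp add: eventually_at_filter flat_def)
  show ?thesis
    using equal filterlim_split_at[OF L R] by (simp add: DERIV_def flat_def)
qed

lemma smooth_flat_mult: "smooth (\<lambda>x. flat p (a * x + b) * flat q (c * x + d))"
proof -
  \<comment> \<open>The constants belong to the generators because the chain rule produces the
    factor \<open>a\<close>.\<close>
  define S where "S = {f. \<exists>q a b. f = (\<lambda>x. flat q (a * x + b))} \<union> {f. \<exists>c::real. f = (\<lambda>_. c)}"
  show ?thesis
  proof (rule smooth_generated_alg[of S])
    fix f assume "f \<in> S"
    then consider q a b where "f = (\<lambda>x. flat q (a * x + b))" | c where "f = (\<lambda>_. c)"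
      unfolding S_def by blast
    then show "\<exists>g\<in>generated_alg S. \<forall>x. (f has_real_derivative g x) (at x)"
    proof cases
      case (1 q a b)
      have D: "(f has_real_derivative flat ([:0, 0, 1:] * (q - pderiv q)) (a * x + b) * a) (at x)" for x
        unfolding 1 by (rule DERIV_chain2[OF flat_has_real_derivative]) (auto intro!: derivative_eq_intros)
      have "(\<lambda>x. flat ([:0, 0, 1:] * (q - pderiv q)) (a * x + b) * a) \<in> generated_alg S"
        by (intro generated_alg.mult[where g = "\<lambda>_. a"] generated_alg.base) (auto simp only: S_def)
      then show ?thesis by (rule bexI[rotated]) (use D in blast)
    next
      case 2
      then show ?thesis
        by (intro bexI[of _ "\<lambda>_. 0"]) (auto intro!: generated_alg.base simp: S_def)
    qed
  next
    show "(\<lambda>x. flat p (a * x + b) * flat q (c * x + d)) \<in> generated_alg S"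
      by (intro generated_alg.mult generated_alg.base) (auto simp only: S_def)
  qed
qed

section \<open>Test functions and bump functions\<close>

lemma vanish_outside_derivative:
  fixes f :: "real \<Rightarrow> 'a::real_normed_vector"
  assumes "\<And>x. x \<notin> {a..b} \<Longrightarrow> f x = 0" "x \<notin> {a..b}" "(f has_vector_derivative d) (at x)"
  shows "d = 0"
proof -
  have "(f has_vector_derivative 0) (at x)"
    by (rule has_vector_derivative_transform_within_open[where S = "- {a..b}" and f = "\<lambda>_. 0"])
      (use assms(2) in \<open>simp_all add: assms(1) open_Compl\<close>)
  then show ?thesis using assms(3) vector_derivative_unique_at by blast
qed

lemma test_functionI:
  assumes "smooth f" "\<And>x. x \<notin> {a..b} \<Longrightarrow> f x = 0"
  shows "test_function f"
proof -
  have "closure {x. f x \<noteq> 0} \<subseteq> {a..b}"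
    using assms(2) by (intro closure_minimal subsetI) (blast, simp)
  then have "bounded (closure {x. f x \<noteq> 0})"
    by (rule bounded_subset[OF compact_imp_bounded[OF compact_Icc]])
  then show ?thesis using assms(1) by (simp add: test_function_def compact_eq_bounded_closed)
qed

lemma test_functionE:
  assumes "test_function f"
  obtains a b where "a < b" "\<forall>x. x \<notin> {a..b} \<longrightarrow> f x = 0"
proof -
  have "bounded {x. f x \<noteq> 0}"
    using assms bounded_subset[OF compact_imp_bounded closure_subset]
    unfolding test_function_def by blast
  then obtain M where M: "\<And>x. f x \<noteq> 0 \<Longrightarrow> \<bar>x\<bar> \<le> M"
    by (auto simp: bounded_iff)
  show ?thesis
  proof (rule that)
    \<comment> \<open>If \<open>f\<close> vanishes identically, \<open>M\<close> may be negative;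
      absolute values and the extra \<open>1\<close> keep the interval nondegenerate.\<close>
    show "- \<bar>M\<bar> - 1 < \<bar>M\<bar> + 1" by simp
    show "\<forall>x. x \<notin> {- \<bar>M\<bar> - 1..\<bar>M\<bar> + 1} \<longrightarrow> f x = 0"
    proof (intro allI impI, rule ccontr)
      fix x assume "x \<notin> {- \<bar>M\<bar> - 1..\<bar>M\<bar> + 1}" and "f x \<noteq> 0"
      from M[OF this(2)] this(1) show False unfolding atLeastAtMost_iff by linarith
    qed
  qed
qed

lemma test_function_smooth: "test_function f \<Longrightarrow> smooth f"
  by (simp add: test_function_def)

lemma test_function_mult:
  fixes f g :: "real \<Rightarrow> real"
  assumes "test_function f" "smooth g"
  shows "test_function (\<lambda>x. f x * g x)"
proof -
  obtain a b where "a < b" and ab: "\<forall>x. x \<notin> {a..b} \<longrightarrow> f x = 0"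
    by (rule test_functionE[OF assms(1)])
  show ?thesis
  proof (rule test_functionI)
    show "smooth (\<lambda>x. f x * g x)"
      using assms by (simp add: smooth_mult test_function_smooth)
    show "f x * g x = 0" if "x \<notin> {a..b}" for x using ab that by simp
  qed
qed

lemma test_function_deriv:
  fixes f :: "real \<Rightarrow> real"
  assumes "test_function f"
  shows "test_function (deriv f)"
proof -
  obtain a b where "a < b" and ab: "\<forall>x. x \<notin> {a..b} \<longrightarrow> f x = 0"
    by (rule test_functionE[OF assms(1)])
  have "(f has_vector_derivative deriv f x) (at x)" for x
    using smooth_deriv_real(1)[OF test_function_smooth[OF assms]]
    by (simp add: has_real_derivative_iff_has_vector_derivative)
  then have "deriv f x = 0" if "x \<notin> {a..b}" for x
    using vanish_outside_derivative[of a b f x] ab that by simp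
  then show ?thesis
    by (rule test_functionI[OF smooth_deriv_real(2)[OF test_function_smooth[OF assms]]])
qed

text \<open>The function \<open>exp (- 1 / (n y))\<close> tends to \<open>1\<close> for
  \<open>y > 0\<close>. Hence a bump built from one such factor at each end of the interval,
  sharpened as \<open>n\<close> grows, converges to the indicator from below.\<close>

lemma indicator_approximation:
  fixes a b :: real
  shows "\<exists>\<psi> :: nat \<Rightarrow> real \<Rightarrow> real. \<forall>n x.
    test_function (\<psi> n) \<and> 0 \<le> \<psi> n x \<and> \<psi> n x \<le> 1 \<and>
    (x \<in> {a<..<b} \<longrightarrow> 0 < \<psi> n x) \<and> (x \<notin> {a<..<b} \<longrightarrow> \<psi> n x = 0) \<and>
    (\<lambda>n. \<psi> n x) \<longlonglongrightarrow> indicator {a<..<b} x"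
proof -
  \<comment> \<open>The arguments are written in the affine form that
    \<open>smooth_flat_mult\<close> expects. With the scale \<open>0\<close> instead of
    \<open>Suc n\<close> the bump would vanish inside the interval.\<close>
  define \<psi> where "\<psi> n x = flat 1 (real (Suc n) * x + - real (Suc n) * a) *
     flat 1 (- real (Suc n) * x + real (Suc n) * b)" for n x
  have psi: "\<psi> n x = flat 1 (real (Suc n) * (x - a)) * flat 1 (real (Suc n) * (b - x))" for n x
  proof -
    have "real (Suc n) * x + - real (Suc n) * a = real (Suc n) * (x - a)"
      "- real (Suc n) * x + real (Suc n) * b = real (Suc n) * (b - x)"
      by (simp_all add: algebra_simps del: of_nat_Suc)
    then show ?thesis unfolding \<psi>_def by (simp only:)
  qed
  have flat0: "flat 1 (real (Suc n) * y) = 0" if "y \<le> 0" for n y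
    using that by (simp add: flat_def mult_le_0_iff not_less del: of_nat_Suc)
  have flat_pos: "0 < flat 1 (real (Suc n) * y)" if "0 < y" for n y
    using that by (simp add: flat_def del: of_nat_Suc)
  have flat01: "0 \<le> flat 1 y" "flat 1 y \<le> 1" for y by (simp_all add: flat_def)
  have out: "\<psi> n x = 0" if "x \<notin> {a<..<b}" for n x
  proof -
    from that have "x - a \<le> 0 \<or> b - x \<le> 0" by auto
    then show ?thesis unfolding psi using flat0 by auto
  qed
  have test: "test_function (\<psi> n)" for n
  proof (rule test_functionI)
    show "smooth (\<psi> n)" unfolding \<psi>_def by (rule smooth_flat_mult)
    show "\<psi> n x = 0" if "x \<notin> {a..b}" for x
      by (rule out) (use that in auto)
  qed
  have bounds: "0 \<le> \<psi> n x" "\<psi> n x \<le> 1" for n x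
    unfolding psi by (simp_all only: mult_nonneg_nonneg mult_le_one flat01)
  have pos: "0 < \<psi> n x" if "x \<in> {a<..<b}" for n x
    using that unfolding psi by (intro mult_pos_pos flat_pos) simp_all
  have lim: "(\<lambda>n. flat 1 (real (Suc n) * y)) \<longlonglongrightarrow> 1" if "y > 0" for y
  proof -
    have "(\<lambda>n. exp (- ((1 / y) * inverse (real (Suc n))))) \<longlonglongrightarrow> exp (- ((1 / y) * 0))"
      by (intro tendsto_exp tendsto_minus tendsto_mult tendsto_const LIMSEQ_inverse_real_of_nat)
    moreover have "flat 1 (real (Suc n) * y) = exp (- ((1 / y) * inverse (real (Suc n))))" for n
      using that by (simp add: flat_def divide_inverse mult.commute del: of_nat_Suc)
    ultimately show ?thesis by (simp del: of_nat_Suc)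
  qed
  have "(\<lambda>n. \<psi> n x) \<longlonglongrightarrow> indicator {a<..<b} x" for x
  proof (cases "x \<in> {a<..<b}")
    case True
    then show ?thesis
      unfolding psi using tendsto_mult[OF lim[of "x - a"] lim[of "b - x"]] by (simp del: of_nat_Suc)
  qed (simp add: out)
  then show ?thesis using out test bounds pos by (intro exI[of _ \<psi>]) blast
qed

section \<open>Locally integrable functions and weak derivatives\<close>

lemma L1_locD:
  fixes f :: "real \<Rightarrow> 'a::euclidean_space"
  assumes "f \<in> L1_loc"
  shows "f \<in> borel_measurable lebesgue" "set_integrable lebesgue {a..b} f"
  using assms by (auto simp: L1_loc_def)

lemma L1_loc_scaleR_continuous:
  fixes f :: "real \<Rightarrow> 'a::euclidean_space" and g :: "real \<Rightarrow> real"
  assumes g: "continuous_on UNIV g" and f: "f \<in> L1_loc"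
  shows "(\<lambda>x. g x *\<^sub>R f x) \<in> L1_loc"
  unfolding L1_loc_def
proof (intro CollectI conjI allI impI)
  have "g \<in> borel_measurable lebesgue"
    using borel_measurable_continuous_onI[OF g] by (simp add: measurable_completion)
  then show meas: "(\<lambda>x. g x *\<^sub>R f x) \<in> borel_measurable lebesgue"
    using L1_locD(1)[OF f] by simp
  fix K :: "real set" assume K: "compact K"
  have "bounded (g ` K)"
    by (rule compact_imp_bounded[OF compact_continuous_image[OF continuous_on_subset[OF g] K]]) simp
  then obtain M where M: "\<forall>x\<in>K. \<bar>g x\<bar> \<le> M"
    by (auto simp: bounded_iff)
  have Kl: "K \<in> sets lebesgue"
    using borel_compact[OF K] by (intro sets_completionI_sets) simp
  have "set_integrable lebesgue K (\<lambda>x. M *\<^sub>R f x)"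
    using f K by (simp add: L1_loc_def)
  then show "set_integrable lebesgue K (\<lambda>x. g x *\<^sub>R f x)"
  proof (rule set_integrable_bound)
    show "set_borel_measurable lebesgue K (\<lambda>x. g x *\<^sub>R f x)"
      unfolding set_borel_measurable_def by (intro borel_measurable_scaleR borel_measurable_indicator meas Kl)
    show "AE x in lebesgue. x \<in> K \<longrightarrow> norm (g x *\<^sub>R f x) \<le> norm (M *\<^sub>R f x)"
    proof (intro AE_I2 impI)
      fix x assume "x \<in> K"
      then have "\<bar>g x\<bar> \<le> \<bar>M\<bar>" using M by force
      then show "norm (g x *\<^sub>R f x) \<le> norm (M *\<^sub>R f x)" by (simp add: mult_right_mono)
    qed
  qed
qed

lemma integrable_test_scaleR:
  fixes f :: "real \<Rightarrow> 'a::euclidean_space" and \<phi> :: "real \<Rightarrow> real"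
  assumes "test_function \<phi>" "f \<in> L1_loc"
  shows "integrable lebesgue (\<lambda>x. \<phi> x *\<^sub>R f x)"
proof -
  obtain a b where "a < b" and ab: "\<forall>x. x \<notin> {a..b} \<longrightarrow> \<phi> x = 0"
    by (rule test_functionE[OF assms(1)])
  have "set_integrable lebesgue {a..b} (\<lambda>x. \<phi> x *\<^sub>R f x)"
    by (intro L1_locD(2) L1_loc_scaleR_continuous smooth_continuous_on test_function_smooth assms)
  moreover have "indicator {a..b} x *\<^sub>R \<phi> x *\<^sub>R f x = \<phi> x *\<^sub>R f x" for x
    using ab by (cases "x \<in> {a..b}") auto
  ultimately show ?thesis unfolding set_integrable_def by (simp only:)
qed

text \<open>Testing with bumps that converge to the indicator gives the integral over the interval
  in the limit; the restriction of \<open>f\<close> to the closed interval dominates.\<close>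

lemma L1_loc_set_integral_zero:
  fixes f :: "real \<Rightarrow> 'a::euclidean_space"
  assumes f: "f \<in> L1_loc"
    and zero: "\<And>\<psi> :: real \<Rightarrow> real. test_function \<psi> \<Longrightarrow> (LINT x|lebesgue. \<psi> x *\<^sub>R f x) = 0"
  shows "(LINT x:{a<..<b}|lebesgue. f x) = 0"
proof -
  obtain \<psi> :: "nat \<Rightarrow> real \<Rightarrow> real" where psi: "\<forall>n x.
    test_function (\<psi> n) \<and> 0 \<le> \<psi> n x \<and> \<psi> n x \<le> 1 \<and>
    (x \<in> {a<..<b} \<longrightarrow> 0 < \<psi> n x) \<and> (x \<notin> {a<..<b} \<longrightarrow> \<psi> n x = 0) \<and>
    (\<lambda>n. \<psi> n x) \<longlonglongrightarrow> indicator {a<..<b} x"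
    using indicator_approximation[of a b] by blast
  have "(\<lambda>n. LINT x|lebesgue. \<psi> n x *\<^sub>R f x) \<longlonglongrightarrow> (LINT x|lebesgue. indicator {a<..<b} x *\<^sub>R f x)"
  proof (rule integral_dominated_convergence[where w = "\<lambda>x. norm (indicator {a..b} x *\<^sub>R f x)"])
    show "(\<lambda>x. indicator {a<..<b} x *\<^sub>R f x) \<in> borel_measurable lebesgue"
      using L1_locD(1)[OF f] by (intro borel_measurable_scaleR borel_measurable_indicator) auto
    show "(\<lambda>x. \<psi> n x *\<^sub>R f x) \<in> borel_measurable lebesgue" for n
      using integrable_test_scaleR[OF _ f] psi by (blast intro: borel_measurable_integrable)
    show "integrable lebesgue (\<lambda>x. norm (indicator {a..b} x *\<^sub>R f x))"
      using L1_locD(2)[OF f] unfolding set_integrable_def by (rule integrable_norm)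
    show "AE x in lebesgue. (\<lambda>n. \<psi> n x *\<^sub>R f x) \<longlonglongrightarrow> indicator {a<..<b} x *\<^sub>R f x"
      using psi by (intro AE_I2 tendsto_scaleR tendsto_const) blast
    show "AE x in lebesgue. norm (\<psi> n x *\<^sub>R f x) \<le> norm (indicator {a..b} x *\<^sub>R f x)" for n
    proof (rule AE_I2)
      fix x
      show "norm (\<psi> n x *\<^sub>R f x) \<le> norm (indicator {a..b} x *\<^sub>R f x)"
      proof (cases "x \<in> {a<..<b}")
        case True
        then show ?thesis using psi by (simp add: mult_left_le_one_le)
      qed (simp add: psi)
    qed
  qed
  moreover have "(LINT x|lebesgue. \<psi> n x *\<^sub>R f x) = 0" for n
    using psi by (intro zero) blast
  ultimately show ?thesis
    unfolding set_lebesgue_integral_def by (simp add: LIMSEQ_const_iff)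
qed

text \<open>A countable cover by Borel sets of finite measure keeps its measures under completion.
  This supplies the hypothesis of \<open>density_zero\<close>.\<close>

lemma sigma_finite_lebesgue: "sigma_finite_measure (lebesgue :: 'a::euclidean_space measure)"
proof
  obtain A :: "'a set set" where A: "countable A" "A \<subseteq> sets lborel" "\<Union>A = space lborel"
    "\<forall>a\<in>A. emeasure lborel a \<noteq> \<infinity>"
    using lborel.sigma_finite_countable by blast
  then have "\<forall>a\<in>A. emeasure lebesgue a \<noteq> \<infinity>" "A \<subseteq> sets lebesgue" "\<Union>A = space lebesgue"
    by (auto simp: subset_eq)
  then show "\<exists>A::'a set set. countable A \<and> A \<subseteq> sets lebesgue \<and> \<Union>A = space lebesgue \<and>
      (\<forall>a\<in>A. emeasure lebesgue a \<noteq> \<infinity>)"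
    using A(1) by blast
qed

text \<open>Dynkin's argument: open intervals are an intersection-stable generator of the Borel
  sets, and the sets on which \<open>g\<close> integrates to zero are closed under complements (by
  \<open>total\<close>) and countable disjoint unions. A Lebesgue set differs from a Borel set by a
  null set, so all integrals vanish.\<close>

lemma AE_zero_if_interval_integrals_zero:
  fixes g :: "real \<Rightarrow> 'a::euclidean_space"
  assumes g: "integrable lebesgue g"
    and total: "(LINT x|lebesgue. g x) = 0"
    and zero: "\<And>a b. (LINT x:{a<..<b}|lebesgue. g x) = 0"
  shows "AE x in lebesgue. g x = 0"
proof (rule sigma_finite_measure.density_zero[OF sigma_finite_lebesgue g])
  have int: "set_integrable lebesgue A g" if "A \<in> sets lebesgue" for A
    using integrable_mult_indicator[OF that g] by (simp add: set_integrable_def)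
  have borel: "(LINT x:A|lebesgue. g x) = 0" if "A \<in> sets borel" for A
  proof -
    define G where "G = range (\<lambda>(a, b). {a<..<b::real})"
    have "(\<lambda>(a, b). box a b) = (\<lambda>(a, b). {a<..<b::real})" by auto
    then have borel_G: "borel = sigma UNIV G"
      unfolding G_def borel_eq_box by (simp only:)
    have sets_G: "sigma_sets UNIV G = sets borel"
      unfolding borel_G by (rule sets_measure_of[symmetric]) simp
    have leb: "A \<in> sets lebesgue" if "A \<in> sigma_sets UNIV G" for A
      using that sets_completionI_sets[of A lborel] unfolding sets_G by simp
    have "Int_stable G"
    proof (rule Int_stableI)
      fix A B assume "A \<in> G" "B \<in> G"
      then obtain a b c d where "A = {a<..<b}" "B = {c<..<d}" by (auto simp: G_def)
      then have "A \<inter> B = {max a c<..<min b d}" by auto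
      then show "A \<inter> B \<in> G" unfolding G_def by (intro range_eqI[of _ _ "(max a c, min b d)"]) simp
    qed
    moreover have "G \<subseteq> Pow UNIV" by simp
    moreover have "A \<in> sigma_sets UNIV G"
      using that unfolding sets_G .
    ultimately show ?thesis
    proof (induction rule: sigma_sets_induct_disjoint)
      case (basic A)
      then show ?case using zero by (auto simp: G_def)
    next
      case empty
      show ?case by (simp add: set_lebesgue_integral_def)
    next
      case (compl A)
      then have "A \<in> sets lebesgue"
        by (intro leb)
      then have "(LINT x:A \<union> (UNIV - A)|lebesgue. g x)
          = (LINT x:A|lebesgue. g x) + (LINT x:UNIV - A|lebesgue. g x)"
        by (intro set_integral_Un int) auto
      then show ?case using compl total by (simp add: set_lebesgue_integral_def)
    next
      case (union A)
      then have "A i \<in> sets lebesgue" for i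
        using leb by blast
      then have "(LINT x:(\<Union>i. A i)|lebesgue. g x) = (\<Sum>i. LINT x:A i|lebesgue. g x)"
        by (intro lebesgue_integral_countable_add int)
          (use union(1) in \<open>auto simp: disjoint_family_on_def\<close>)
      then show ?case using union by simp
    qed
  qed
  fix A :: "real set" assume "A \<in> sets lebesgue"
  then obtain S N N' where A: "A = S \<union> N" "N \<subseteq> N'" "N' \<in> null_sets lborel" "S \<in> sets lborel"
    by (rule sets_completionE)
  have "AE x in lebesgue. x \<notin> N'"
    by (intro AE_not_in null_sets_completionI A(3))
  then have "AE x in lebesgue. x \<in> S \<longleftrightarrow> x \<in> A"
    by eventually_elim (use A in auto)
  moreover have "S \<in> sets lebesgue" using A(4) by (rule sets_completionI_sets)
  ultimately have "(LINT x:A|lebesgue. g x) = (LINT x:S|lebesgue. g x)"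
    using \<open>A \<in> sets lebesgue\<close> borel_measurable_integrable[OF g]
    by (intro set_integral_cong_set)
      (simp_all add: set_borel_measurable_def borel_measurable_scaleR borel_measurable_indicator)
  also have "\<dots> = 0" using A(4) by (intro borel) simp
  finally show "(LINT x:A|lebesgue. g x) = 0" .
qed

text \<open>Fundamental lemma of the calculus of variations. Cutting off to \<open>(-N, N)\<close>
  makes \<open>f\<close> integrable, and an interval integral of the cut-off function is an integral
  of \<open>f\<close> over a smaller interval. Countably many \<open>N\<close> exhaust the
  line.\<close>

lemma L1_loc_AE_zero:
  fixes f :: "real \<Rightarrow> 'a::euclidean_space"
  assumes f: "f \<in> L1_loc"
    and zero: "\<And>\<psi> :: real \<Rightarrow> real. test_function \<psi> \<Longrightarrow> (LINT x|lebesgue. \<psi> x *\<^sub>R f x) = 0"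
  shows "AE x in lebesgue. f x = 0"
proof -
  have "AE x in lebesgue. indicator {- real N<..<real N} x *\<^sub>R f x = 0" for N
  proof (rule AE_zero_if_interval_integrals_zero)
    have "set_integrable lebesgue {- real N<..<real N} f"
      by (rule set_integrable_subset[OF L1_locD(2)[OF f, of "- real N" "real N"]]) auto
    then show "integrable lebesgue (\<lambda>x. indicator {- real N<..<real N} x *\<^sub>R f x)"
      by (simp add: set_integrable_def)
    show "(LINT x|lebesgue. indicator {- real N<..<real N} x *\<^sub>R f x) = 0"
      using L1_loc_set_integral_zero[OF f zero, of "- real N" "real N"]
      by (simp add: set_lebesgue_integral_def)
    fix a b
    have "indicator {a<..<b} x *\<^sub>R indicator {- real N<..<real N} x *\<^sub>R f x
        = indicator {max a (- real N)<..<min b (real N)} x *\<^sub>R f x" for x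
      by (simp add: indicator_def)
    then show "(LINT x:{a<..<b}|lebesgue. indicator {- real N<..<real N} x *\<^sub>R f x) = 0"
      using L1_loc_set_integral_zero[OF f zero, of "max a (- real N)" "min b (real N)"]
      by (simp only: set_lebesgue_integral_def)
  qed
  then have "AE x in lebesgue. \<forall>N. indicator {- real N<..<real N} x *\<^sub>R f x = 0"
    by (subst AE_all_countable) blast
  then show ?thesis
  proof eventually_elim
    case (elim x)
    obtain N where "\<bar>x\<bar> < real N" using reals_Archimedean2 by blast
    then show ?case using elim[rule_format, of N] by (simp add: indicator_def abs_less_iff)
  qed
qed

section \<open>Primitives of test functions and the du Bois-Reymond lemma\<close>

lemma test_function_integral:
  fixes h :: "real \<Rightarrow> real"
  assumes h: "test_function h" and ab: "\<forall>x. x \<notin> {a..b} \<longrightarrow> h x = 0"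
  shows "(LINT x|lebesgue. h x) = integral {a..b} h"
proof -
  have "h absolutely_integrable_on {a..b}"
    by (rule absolutely_integrable_continuous_real[OF smooth_continuous_on[OF test_function_smooth[OF h]]])
  then have "(LINT x:{a..b}|lebesgue. h x) = integral {a..b} h"
    by (rule set_lebesgue_integral_eq_integral(2))
  moreover have "indicator {a..b} x *\<^sub>R h x = h x" for x
    using ab by (cases "x \<in> {a..b}") auto
  ultimately show ?thesis by (simp only: set_lebesgue_integral_def)
qed

text \<open>The integral from the left end of the support vanishes before the support, and after it
  because the total mass is zero.\<close>

lemma test_function_primitive:
  fixes h :: "real \<Rightarrow> real"
  assumes h: "test_function h" and int0: "(LINT x|lebesgue. h x) = 0"
  shows "\<exists>\<Phi>. test_function \<Phi> \<and> deriv \<Phi> = h"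
proof -
  obtain a b where "a < b" and ab: "\<forall>x. x \<notin> {a..b} \<longrightarrow> h x = 0"
    by (rule test_functionE[OF h])
  have cont: "continuous_on S h" for S
    by (rule smooth_continuous_on[OF test_function_smooth[OF h]])
  have int: "h integrable_on {p..q}" for p q by (rule integrable_continuous_real[OF cont])
  define \<Phi> where "\<Phi> x = integral {a..x} h" for x
  \<comment> \<open>The value of \<open>h\<close> at \<open>a\<close> itself is not known to vanish,
    so a single point is discarded.\<close>
  have low: "integral {p..x} h = 0" if "x \<le> a" for p x
  proof -
    have "integral {p..x} h = integral {p..x} (\<lambda>_. 0)"
      by (rule integral_spike[where S = "{a}"]) (use ab that in auto)
    then show ?thesis by simp
  qed
  \<comment> \<open>For \<open>x <= a\<close> the interval \<open>{a..x}\<close> is degenerate. A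
    base point \<open>p\<close> further left places \<open>x\<close> in the interior of an interval,
    which gives a two-sided derivative.\<close>
  have \<Phi>_eq: "\<Phi> x = integral {p..x} h" if "p \<le> a" for p x
  proof (cases "x \<le> a")
    case True
    then show ?thesis unfolding \<Phi>_def using low by simp
  next
    case False
    then have "integral {p..a} h + integral {a..x} h = integral {p..x} h"
      using that by (intro Henstock_Kurzweil_Integration.integral_combine int) auto
    then show ?thesis unfolding \<Phi>_def using low by simp
  qed
  have deriv: "(\<Phi> has_vector_derivative h x) (at x)" for x
  proof -
    define p q where "p = min a x - 1" and "q = x + 1"
    have "((\<lambda>y. integral {p..y} h) has_vector_derivative h x) (at x within {p..q})"
      by (rule integral_has_vector_derivative[OF cont]) (auto simp: p_def q_def)
    moreover have "(\<lambda>y. integral {p..y} h) = \<Phi>"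
      using \<Phi>_eq[of p] by (auto simp: p_def)
    moreover have "at x within {p..q} = at x"
      by (rule at_within_Icc_at) (auto simp: p_def q_def)
    ultimately show ?thesis by simp
  qed
  have "\<Phi> x = 0" if "x \<notin> {a..b}" for x
  proof (cases "x \<le> a")
    case True
    then show ?thesis unfolding \<Phi>_def by (rule low)
  next
    case False
    then have x: "a \<le> b" "b \<le> x" using that \<open>a < b\<close> by auto
    have "integral {b..x} h = integral {b..x} (\<lambda>_. 0)"
      by (rule integral_spike[where S = "{b}"]) (use ab in auto)
    moreover have "integral {a..b} h + integral {b..x} h = \<Phi> x"
      unfolding \<Phi>_def using x by (intro Henstock_Kurzweil_Integration.integral_combine int) auto
    ultimately show ?thesis using int0 test_function_integral[OF h ab] by simp
  qed
  then have "test_function \<Phi>"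
    by (rule test_functionI[OF smooth_primitive[OF test_function_smooth[OF h] deriv]])
  moreover have "deriv \<Phi> = h"
    using deriv by (intro ext DERIV_imp_deriv) (simp add: has_real_derivative_iff_has_vector_derivative)
  ultimately show ?thesis by blast
qed

lemma L1_loc_continuous:
  fixes f :: "real \<Rightarrow> 'a::euclidean_space"
  assumes f: "continuous_on UNIV f"
  shows "f \<in> L1_loc"
  unfolding L1_loc_def
proof (intro CollectI conjI allI impI)
  show "f \<in> borel_measurable lebesgue"
    using borel_measurable_continuous_onI[OF f] by (simp add: measurable_completion)
  fix K :: "real set" assume "compact K"
  then obtain r where r: "\<forall>x\<in>K. norm x \<le> r"
    using compact_imp_bounded[OF \<open>compact K\<close>] unfolding bounded_iff by blast
  have "set_integrable lebesgue {- r..r} f"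
    by (rule absolutely_integrable_continuous_real[OF continuous_on_subset[OF f]]) simp
  then show "set_integrable lebesgue K f"
  proof (rule set_integrable_subset)
    show "K \<in> sets lebesgue"
      using borel_compact[OF \<open>compact K\<close>] by (intro sets_completionI_sets) simp
    show "K \<subseteq> {- r..r}"
      using r by (auto simp: abs_le_iff)
  qed
qed

lemma L1_loc_diff:
  fixes f g :: "real \<Rightarrow> 'a::euclidean_space"
  shows "f \<in> L1_loc \<Longrightarrow> g \<in> L1_loc \<Longrightarrow> (\<lambda>x. f x - g x) \<in> L1_loc"
  unfolding L1_loc_def by (auto intro: borel_measurable_diff set_integral_diff(1))

lemma L1_loc_add:
  fixes f g :: "real \<Rightarrow> 'a::euclidean_space"
  shows "f \<in> L1_loc \<Longrightarrow> g \<in> L1_loc \<Longrightarrow> (\<lambda>x. f x + g x) \<in> L1_loc"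
  unfolding L1_loc_def by (auto intro: borel_measurable_add set_integral_add(1))

text \<open>Du Bois-Reymond. Subtracting from a test function \<open>\<psi>\<close> the multiple of
  a fixed bump \<open>\<rho>\<close> with the same mass leaves the derivative of a test function,
  which \<open>v\<close> annihilates. So \<open>v\<close> and its \<open>\<rho>\<close>-mean
  \<open>d\<close> have the same integral against every \<open>\<psi>\<close>.\<close>

lemma L1_loc_AE_const:
  fixes v :: "real \<Rightarrow> real"
  assumes v: "v \<in> L1_loc"
    and zero: "\<And>\<phi> :: real \<Rightarrow> real. test_function \<phi> \<Longrightarrow> (LINT x|lebesgue. deriv \<phi> x * v x) = 0"
  shows "\<exists>d. AE x in lebesgue. v x = d"
proof -
  obtain \<psi>s :: "nat \<Rightarrow> real \<Rightarrow> real" where psis: "\<forall>n x.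
    test_function (\<psi>s n) \<and> 0 \<le> \<psi>s n x \<and> \<psi>s n x \<le> 1 \<and>
    (x \<in> {0<..<1} \<longrightarrow> 0 < \<psi>s n x) \<and> (x \<notin> {0<..<1} \<longrightarrow> \<psi>s n x = 0) \<and>
    (\<lambda>n. \<psi>s n x) \<longlonglongrightarrow> indicator {0<..<1} x"
    using indicator_approximation[of 0 1] by blast
  define \<rho> where "\<rho> = \<psi>s 0"
  have rho: "test_function \<rho>" "\<And>x. 0 \<le> \<rho> x" "\<And>x. x \<in> {0<..<1} \<Longrightarrow> 0 < \<rho> x"
    using psis unfolding \<rho>_def by blast+
  have one: "(\<lambda>_. 1 :: real) \<in> L1_loc" by (rule L1_loc_continuous) simp
  have int: "integrable lebesgue \<psi>" if "test_function \<psi>" for \<psi> :: "real \<Rightarrow> real"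
    using integrable_test_scaleR[OF that one] by simp
  have intv: "integrable lebesgue (\<lambda>x. \<psi> x * v x)" if "test_function \<psi>" for \<psi>
    using integrable_test_scaleR[OF that v] by simp
  define m where "m = (LINT x|lebesgue. \<rho> x)"
  \<comment> \<open>A bump of mass zero would vanish almost everywhere, but \<open>\<rho>\<close> is
    positive on the whole unit interval.\<close>
  have "m \<noteq> 0"
  proof
    assume "m = 0"
    then have "AE x in lebesgue. \<rho> x = 0"
      unfolding m_def using integral_nonneg_eq_0_iff_AE[OF int[OF rho(1)]] rho(2) by simp
    then have "AE x in lebesgue. x \<notin> {0<..<1::real}"
      by eventually_elim (use rho(3) in force)
    then have "{0<..<1::real} \<in> null_sets lebesgue"
      by (subst AE_iff_null_sets) auto
    then show False by (simp add: null_sets_def)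
  qed
  define d where "d = (LINT x|lebesgue. \<rho> x * v x) / m"
  have "AE x in lebesgue. v x - d = 0"
  proof (rule L1_loc_AE_zero)
    show "(\<lambda>x. v x - d) \<in> L1_loc"
      by (intro L1_loc_diff v L1_loc_continuous) simp
    fix \<psi> :: "real \<Rightarrow> real" assume psi: "test_function \<psi>"
    \<comment> \<open>The factor that gives \<open>h\<close> total integral zero.\<close>
    define k where "k = (LINT x|lebesgue. \<psi> x) / m"
    define h where "h x = \<psi> x + \<rho> x * (- k)" for x
    have h: "test_function h"
    proof -
      have rk: "test_function (\<lambda>x. \<rho> x * (- k))"
        by (rule test_function_mult[OF rho(1) smooth_const])
      obtain a b where 1: "\<forall>x. x \<notin> {a..b} \<longrightarrow> \<psi> x = 0" using test_functionE[OF psi] by metis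
      obtain a' b' where 2: "\<forall>x. x \<notin> {a'..b'} \<longrightarrow> \<rho> x = 0" using test_functionE[OF rho(1)] by metis
      show ?thesis
      proof (rule test_functionI)
        show "smooth h" unfolding h_def
          by (rule smooth_add[OF test_function_smooth[OF psi] test_function_smooth[OF rk]])
        show "h x = 0" if "x \<notin> {min a a'..max b b'}" for x
        proof -
          have "x \<notin> {a..b}" "x \<notin> {a'..b'}" using that by auto
          then show ?thesis unfolding h_def using 1 2 by simp
        qed
      qed
    qed
    have "(LINT x|lebesgue. h x) = (LINT x|lebesgue. \<psi> x) - k * m"
      unfolding h_def m_def using int[OF psi] int[OF rho(1)] by simp
    then have "(LINT x|lebesgue. h x) = 0" using \<open>m \<noteq> 0\<close> by (simp add: k_def)
    from test_function_primitive[OF h this] obtain \<Phi> where "test_function \<Phi>" "deriv \<Phi> = h" by blast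
    then have "(LINT x|lebesgue. h x * v x) = 0" using zero by blast
    moreover have "(LINT x|lebesgue. h x * v x)
        = (LINT x|lebesgue. \<psi> x * v x) - k * (LINT x|lebesgue. \<rho> x * v x)"
    proof -
      have "h x * v x = \<psi> x * v x - k * (\<rho> x * v x)" for x by (simp add: h_def algebra_simps)
      then show ?thesis using intv[OF psi] intv[OF rho(1)] by simp
    qed
    moreover have "(LINT x|lebesgue. \<psi> x *\<^sub>R (v x - d))
        = (LINT x|lebesgue. \<psi> x * v x) - (LINT x|lebesgue. \<psi> x) * d"
      using intv[OF psi] int[OF psi] by (simp add: right_diff_distrib)
    ultimately show "(LINT x|lebesgue. \<psi> x *\<^sub>R (v x - d)) = 0"
      using \<open>m \<noteq> 0\<close> by (simp add: k_def d_def)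
  qed
  then show ?thesis by (intro exI[of _ d]) simp
qed

section \<open>Calculus of weak derivatives\<close>

lemma L1_loc_mult_continuous:
  fixes f g :: "real \<Rightarrow> real"
  shows "continuous_on UNIV g \<Longrightarrow> f \<in> L1_loc \<Longrightarrow> (\<lambda>x. g x * f x) \<in> L1_loc"
  using L1_loc_scaleR_continuous[of g f] by simp

lemma L1_loc_inner:
  fixes f :: "real \<Rightarrow> 'a::euclidean_space"
  assumes f: "f \<in> L1_loc"
  shows "(\<lambda>x. f x \<bullet> e) \<in> L1_loc"
  unfolding L1_loc_def
proof (intro CollectI conjI allI impI)
  show "(\<lambda>x. f x \<bullet> e) \<in> borel_measurable lebesgue"
    using L1_locD(1)[OF f] by simp
  fix K :: "real set" assume "compact K"
  then have "integrable lebesgue (\<lambda>x. (indicator K x *\<^sub>R f x) \<bullet> e)"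
    using f by (intro integrable_inner_left) (simp add: L1_loc_def set_integrable_def)
  then show "set_integrable lebesgue K (\<lambda>x. f x \<bullet> e)"
    by (simp add: set_integrable_def)
qed

lemma has_weak_deriv_inner:
  fixes v w :: "real \<Rightarrow> 'a::euclidean_space"
  assumes "has_weak_deriv v w"
  shows "has_weak_deriv (\<lambda>x. v x \<bullet> e) (\<lambda>x. w x \<bullet> e)"
  unfolding has_weak_deriv_def
proof (intro conjI allI impI)
  have vw: "v \<in> L1_loc" "w \<in> L1_loc" using assms by (simp_all add: has_weak_deriv_def)
  then show "(\<lambda>x. v x \<bullet> e) \<in> L1_loc" "(\<lambda>x. w x \<bullet> e) \<in> L1_loc" by (simp_all add: L1_loc_inner)
  fix \<phi> :: "real \<Rightarrow> real" assume phi: "test_function \<phi>"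
  have "(LINT x|lebesgue. deriv \<phi> x *\<^sub>R v x) = - (LINT x|lebesgue. \<phi> x *\<^sub>R w x)"
    using assms phi by (simp add: has_weak_deriv_def)
  moreover have "(LINT x|lebesgue. (deriv \<phi> x *\<^sub>R v x) \<bullet> e) = (LINT x|lebesgue. deriv \<phi> x *\<^sub>R v x) \<bullet> e"
    by (rule integral_inner_left) (rule integrable_test_scaleR[OF test_function_deriv[OF phi] vw(1)])
  moreover have "(LINT x|lebesgue. (\<phi> x *\<^sub>R w x) \<bullet> e) = (LINT x|lebesgue. \<phi> x *\<^sub>R w x) \<bullet> e"
    by (rule integral_inner_left) (rule integrable_test_scaleR[OF phi vw(2)])
  ultimately have "(LINT x|lebesgue. (deriv \<phi> x *\<^sub>R v x) \<bullet> e) = - (LINT x|lebesgue. (\<phi> x *\<^sub>R w x) \<bullet> e)"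
    by simp
  then show "(LINT x|lebesgue. deriv \<phi> x *\<^sub>R (v x \<bullet> e)) = - (LINT x|lebesgue. \<phi> x *\<^sub>R (w x \<bullet> e))"
    by simp
qed

text \<open>The difference of two weak derivatives integrates to zero against every test function.
  This makes the arbitrary representative chosen by \<open>wderiv\<close> harmless.\<close>

lemma has_weak_deriv_AE_unique:
  fixes v w w' :: "real \<Rightarrow> 'a::euclidean_space"
  assumes "has_weak_deriv v w" "has_weak_deriv v w'"
  shows "AE x in lebesgue. w x = w' x"
proof -
  have w: "w \<in> L1_loc" "w' \<in> L1_loc" using assms by (simp_all add: has_weak_deriv_def)
  have "AE x in lebesgue. w x - w' x = 0"
  proof (rule L1_loc_AE_zero[OF L1_loc_diff[OF w]])
    fix \<psi> :: "real \<Rightarrow> real" assume psi: "test_function \<psi>"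
    then have "(LINT x|lebesgue. \<psi> x *\<^sub>R w x) = (LINT x|lebesgue. \<psi> x *\<^sub>R w' x)"
      using assms by (simp add: has_weak_deriv_def)
    then show "(LINT x|lebesgue. \<psi> x *\<^sub>R (w x - w' x)) = 0"
      using integrable_test_scaleR[OF psi w(1)] integrable_test_scaleR[OF psi w(2)]
      by (simp add: scaleR_diff_right)
  qed
  then show ?thesis by simp
qed

text \<open>Test \<open>v\<close> with \<open>\<phi> * \<psi>\<close> and move one term of the
  product rule to the other side. This identifies the weak derivative of
  \<open>u \<bullet> \<phi>\<close> in the weak equation.\<close>

lemma has_weak_deriv_test_mult:
  fixes v w \<psi> :: "real \<Rightarrow> real"
  assumes vw: "has_weak_deriv v w" and psi: "test_function \<psi>"
  shows "has_weak_deriv (\<lambda>x. \<psi> x * v x) (\<lambda>x. deriv \<psi> x * v x + \<psi> x * w x)"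
  unfolding has_weak_deriv_def
proof (intro conjI allI impI)
  have L: "v \<in> L1_loc" "w \<in> L1_loc" using vw by (simp_all add: has_weak_deriv_def)
  have smooth: "smooth \<psi>" "smooth (deriv \<psi>)"
    using psi by (simp_all add: test_function_smooth smooth_deriv_real)
  show "(\<lambda>x. \<psi> x * v x) \<in> L1_loc" "(\<lambda>x. deriv \<psi> x * v x + \<psi> x * w x) \<in> L1_loc"
    using L smooth by (simp_all add: L1_loc_add L1_loc_mult_continuous smooth_continuous_on)
  fix \<phi> :: "real \<Rightarrow> real" assume phi: "test_function \<phi>"
  have test: "test_function (\<lambda>x. \<phi> x * \<psi> x)" "test_function (\<lambda>x. \<phi> x * deriv \<psi> x)"
    "test_function (\<lambda>x. deriv \<phi> x * \<psi> x)"
    using phi smooth by (simp_all add: test_function_mult test_function_deriv)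
  have "deriv (\<lambda>x. \<phi> x * \<psi> x) x = deriv \<phi> x * \<psi> x + \<phi> x * deriv \<psi> x" for x
    using DERIV_mult[OF smooth_deriv_real(1)[OF test_function_smooth[OF phi]] smooth_deriv_real(1)[OF smooth(1)]]
    by (auto intro!: DERIV_imp_deriv simp: algebra_simps)
  moreover have "(LINT x|lebesgue. deriv (\<lambda>x. \<phi> x * \<psi> x) x * v x) = - (LINT x|lebesgue. (\<phi> x * \<psi> x) * w x)"
    using vw test(1) by (simp add: has_weak_deriv_def)
  ultimately have eq: "(LINT x|lebesgue. deriv \<phi> x * \<psi> x * v x + \<phi> x * deriv \<psi> x * v x)
      = - (LINT x|lebesgue. \<phi> x * \<psi> x * w x)"
    by (simp add: distrib_right)
  have int: "integrable lebesgue (\<lambda>x. \<phi> x * \<psi> x * w x)"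
    "integrable lebesgue (\<lambda>x. \<phi> x * deriv \<psi> x * v x)"
    "integrable lebesgue (\<lambda>x. deriv \<phi> x * \<psi> x * v x)"
    using integrable_test_scaleR[OF test(1) L(2)] integrable_test_scaleR[OF test(2) L(1)]
      integrable_test_scaleR[OF test(3) L(1)] by simp_all
  have "(LINT x|lebesgue. deriv \<phi> x * \<psi> x * v x)
      = - (LINT x|lebesgue. \<phi> x * deriv \<psi> x * v x + \<phi> x * \<psi> x * w x)"
    using eq int by simp
  then show "(LINT x|lebesgue. deriv \<phi> x *\<^sub>R (\<psi> x * v x))
      = - (LINT x|lebesgue. \<phi> x *\<^sub>R (deriv \<psi> x * v x + \<psi> x * w x))"
    by (simp add: distrib_left mult.assoc)
qed

text \<open>One of the two intervals is empty unless \<open>x = 0\<close>, so this is the oriented integral from \<open>0\<close> to \<open>x\<close>.\<close>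

definition primitive :: "(real \<Rightarrow> 'a::euclidean_space) \<Rightarrow> real \<Rightarrow> 'a" where
  "primitive w x = integral {0..x} w - integral {x..0} w"

lemma L1_loc_integrable_on:
  "w \<in> L1_loc \<Longrightarrow> w integrable_on {a..b}" for w :: "real \<Rightarrow> 'a::euclidean_space"
  by (rule set_lebesgue_integral_eq_integral(1)[OF L1_locD(2)])

lemma primitive_eq:
  fixes w :: "real \<Rightarrow> 'a::euclidean_space"
  assumes w: "w \<in> L1_loc" and xy: "x \<le> y"
  shows "primitive w y = primitive w x + integral {x..y} w"
proof -
  \<comment> \<open>A reversed interval is empty and a one-point interval is negligible, so exactly
    the inactive half of \<open>primitive\<close> drops out.\<close>
  have zero: "integral {p..q} w = 0" if "q \<le> p" for p q
    using that by (cases "p = q") auto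
  have comb: "integral {p..q} w + integral {q..r} w = integral {p..r} w" if "p \<le> q" "q \<le> r" for p q r
    using that by (intro Henstock_Kurzweil_Integration.integral_combine L1_loc_integrable_on[OF w])
  consider "0 \<le> x" | "x \<le> 0" "0 \<le> y" | "y \<le> 0" by linarith
  then show ?thesis
  proof cases
    case 1
    then show ?thesis
      unfolding primitive_def comb[OF 1 xy, symmetric] zero[OF 1] zero[OF order.trans[OF 1 xy]] by simp
  next
    case 2
    then show ?thesis
      unfolding primitive_def comb[OF 2, symmetric] zero[OF 2(1)] zero[OF 2(2)] by simp
  next
    case 3
    then show ?thesis
      unfolding primitive_def comb[OF xy 3, symmetric] zero[OF 3] zero[OF order.trans[OF xy 3]] by simp
  qed
qed

lemma continuous_on_primitive:
  fixes w :: "real \<Rightarrow> 'a::euclidean_space"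
  assumes w: "w \<in> L1_loc"
  shows "continuous_on UNIV (primitive w)"
proof (rule continuous_at_imp_continuous_on, rule ballI)
  fix x :: real
  have "continuous_on {x - 1..x + 1} (\<lambda>y. primitive w (x - 1) + integral {x - 1..y} w)"
    by (intro continuous_intros indefinite_integral_continuous_1 L1_loc_integrable_on[OF w])
  then have "continuous_on {x - 1..x + 1} (primitive w)"
    by (rule continuous_on_eq) (simp only: primitive_eq[OF w, of "x - 1", symmetric] atLeastAtMost_iff)
  then show "isCont (primitive w) x"
    by (rule continuous_on_interior) simp
qed

lemma integral_deriv_smooth:
  fixes \<phi> :: "real \<Rightarrow> real"
  assumes "smooth \<phi>" "a \<le> b"
  shows "integral {a..b} (deriv \<phi>) = \<phi> b - \<phi> a"
proof (rule integral_unique, rule fundamental_theorem_of_calculus[OF assms(2)])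
  fix x
  show "(\<phi> has_vector_derivative deriv \<phi> x) (at x within {a..b})"
    using smooth_deriv_real(1)[OF assms(1)]
    by (simp add: has_real_derivative_iff_has_vector_derivative has_vector_derivative_at_within)
qed

text \<open>Integration by parts for a merely locally integrable \<open>w\<close>, by Fubini on the
  triangle \<open>t <= x\<close>. Integrating \<open>deriv \<phi> x * w t\<close> first in
  \<open>t\<close> gives an increment of \<open>primitive w\<close>, first in \<open>x\<close> it
  gives \<open>- \<phi> t * w t\<close>. The base value \<open>primitive w a\<close> disappears
  because \<open>deriv \<phi>\<close> has integral zero.\<close>

lemma integral_primitive_mult_deriv:
  fixes w \<phi> :: "real \<Rightarrow> real"
  assumes w: "w \<in> L1_loc" and phi: "test_function \<phi>"
  shows "(LINT x|lebesgue. deriv \<phi> x * primitive w x) = - (LINT x|lebesgue. \<phi> x * w x)"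
proof -
  obtain p q where "p < q" and pq: "\<forall>x. x \<notin> {p..q} \<longrightarrow> \<phi> x = 0"
    by (rule test_functionE[OF phi])
  \<comment> \<open>The interval is widened so that \<open>\<phi>\<close> vanishes at both
    endpoints.\<close>
  define a b where "a = p - 1" and "b = q + 1"
  have ab: "a < b" "\<phi> a = 0" "\<phi> b = 0" and phi0: "\<And>x. x \<notin> {a..b} \<Longrightarrow> \<phi> x = 0"
    using pq \<open>p < q\<close> by (auto simp: a_def b_def)
  have smooth: "smooth \<phi>" "smooth (deriv \<phi>)"
    using phi by (simp_all add: test_function_smooth smooth_deriv_real)
  have D0: "deriv \<phi> x = 0" if "x \<notin> {a..b}" for x
    using vanish_outside_derivative[OF phi0 that] smooth_deriv_real(1)[OF smooth(1)]
    by (simp add: has_real_derivative_iff_has_vector_derivative)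
  \<comment> \<open>Fubini is applied to products of \<open>lborel\<close>, so the Lebesgue
    measurable \<open>w\<close> is replaced by a Borel function equal to it almost
    everywhere.\<close>
  have "w \<in> borel_measurable (completion lborel)"
    using L1_locD(1)[OF w] .
  from completion_ex_borel_measurable_real[OF this] obtain g
    where g[measurable]: "g \<in> borel_measurable lborel" and "AE x in lborel. w x = g x" by blast
  then have ae: "AE x in lebesgue. w x = g x" by (intro AE_completion)
  define G where "G t = indicator {a..b} t * g t" for t
  have G_meas[measurable]: "G \<in> borel_measurable lborel" unfolding G_def by measurable
  have leb: "integrable lborel f \<longleftrightarrow> integrable lebesgue f"
    "(LINT x|lborel. f x) = (LINT x|lebesgue. f x)"
    if "f \<in> borel_measurable lborel" for f :: "real \<Rightarrow> real"
    using that by (simp_all add: integrable_completion integral_completion)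
  have "integrable lebesgue (\<lambda>t. indicator {a..b} t * w t)"
    using L1_locD(2)[OF w] by (simp add: set_integrable_def)
  then have "integrable lebesgue G"
    by (rule Bochner_Integration.integrable_cong_AE_imp)
      (use G_meas ae in \<open>auto simp: measurable_completion G_def elim: eventually_mono\<close>)
  then have G: "integrable lborel G" by (simp add: leb)
  have D_meas[measurable]: "deriv \<phi> \<in> borel_measurable lborel"
    using borel_measurable_continuous_onI[OF smooth_continuous_on[OF smooth(2)]] by simp
  have "integrable lebesgue (deriv \<phi>)"
    using integrable_test_scaleR[OF test_function_deriv[OF phi] L1_loc_continuous[of "\<lambda>_. 1::real"]]
    by simp
  then have D: "integrable lborel (deriv \<phi>)" by (simp add: leb)
  define F where "F x t = indicator {..x} t * (deriv \<phi> x * G t)" for x t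
  have "integrable (lborel \<Otimes>\<^sub>M lborel) (\<lambda>(x, t). deriv \<phi> x * G t)"
    by (rule lborel_pair.Fubini_integrable) (use D G in \<open>auto simp: abs_mult\<close>)
  then have F: "integrable (lborel \<Otimes>\<^sub>M lborel) (\<lambda>(x, t). F x t)"
  proof (rule Bochner_Integration.integrable_bound)
    have "(\<lambda>(x, t). if t \<le> x then deriv \<phi> x * G t else 0) \<in> borel_measurable (lborel \<Otimes>\<^sub>M lborel)"
      by measurable
    also have "(\<lambda>(x, t). if t \<le> x then deriv \<phi> x * G t else 0) = (\<lambda>(x, t). F x t)"
      by (auto simp: F_def fun_eq_iff)
    finally show "(\<lambda>(x, t). F x t) \<in> borel_measurable (lborel \<Otimes>\<^sub>M lborel)" .
  qed (auto simp: F_def indicator_def)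
  have inner1: "(LINT t|lborel. F x t) = deriv \<phi> x * (primitive w x - primitive w a)" for x
  proof (cases "x \<in> {a..b}")
    case True
    have "(LINT t|lborel. F x t) = deriv \<phi> x * (LINT t|lborel. indicator {..x} t * G t)"
      by (simp add: F_def mult.left_commute)
    also have "(LINT t|lborel. indicator {..x} t * G t) = (LINT t|lebesgue. indicator {..x} t * G t)"
      by (rule leb) measurable
    also have "\<dots> = (LINT t|lebesgue. indicator {a..x} t *\<^sub>R w t)"
    proof (rule integral_cong_AE)
      show "(\<lambda>t. indicator {..x} t * G t) \<in> borel_measurable lebesgue"
        by (rule measurable_completion) measurable
      show "(\<lambda>t. indicator {a..x} t *\<^sub>R w t) \<in> borel_measurable lebesgue"
        using L1_locD(2)[OF w, of a x] unfolding set_integrable_def by (rule borel_measurable_integrable)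
      show "AE t in lebesgue. indicator {..x} t * G t = indicator {a..x} t *\<^sub>R w t"
        using ae by eventually_elim (use True in \<open>auto simp: G_def indicator_def\<close>)
    qed
    also have "\<dots> = integral {a..x} w"
      using set_lebesgue_integral_eq_integral(2)[OF L1_locD(2)[OF w, of a x]]
      by (simp only: set_lebesgue_integral_def)
    also have "\<dots> = primitive w x - primitive w a"
      using primitive_eq[OF w, of a x] True by simp
    finally show ?thesis .
  qed (simp add: F_def D0)
  have inner2: "(LINT x|lborel. F x t) = - (\<phi> t * G t)" for t
  proof (cases "t \<in> {a..b}")
    case True
    have "(LINT x|lborel. F x t) = G t * (LINT x|lborel. indicator {t..} x * deriv \<phi> x)"
      unfolding F_def by (subst integral_mult_right_zero[symmetric], rule Bochner_Integration.integral_cong)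
        (auto simp: indicator_def)
    also have "(LINT x|lborel. indicator {t..} x * deriv \<phi> x) = (LINT x|lebesgue. indicator {t..} x * deriv \<phi> x)"
      by (rule leb) measurable
    also have "(\<lambda>x. indicator {t..} x * deriv \<phi> x) = (\<lambda>x. indicator {t..b} x *\<^sub>R deriv \<phi> x)"
      using D0 True by (auto simp: indicator_def fun_eq_iff)
    also have "(LINT x|lebesgue. indicator {t..b} x *\<^sub>R deriv \<phi> x) = integral {t..b} (deriv \<phi>)"
      using set_lebesgue_integral_eq_integral(2)[OF absolutely_integrable_continuous_real[OF smooth_continuous_on[OF smooth(2)]], of t b]
      by (simp only: set_lebesgue_integral_def)
    also have "\<dots> = - \<phi> t"
      using True ab by (simp add: integral_deriv_smooth[OF smooth(1)])
    finally show ?thesis by simp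
  qed (simp add: F_def G_def)
  have "(LINT x|lborel. LINT t|lborel. F x t) = (LINT t|lborel. LINT x|lborel. F x t)"
    using lborel_pair.Fubini_integral[OF F] by simp
  then have "(LINT x|lborel. deriv \<phi> x * (primitive w x - primitive w a)) = - (LINT t|lborel. \<phi> t * G t)"
    by (simp add: inner1 inner2)
  moreover have prim_meas: "primitive w \<in> borel_measurable lborel"
    using borel_measurable_continuous_onI[OF continuous_on_primitive[OF w]] by simp
  moreover have phi_meas: "\<phi> \<in> borel_measurable lborel"
    using borel_measurable_continuous_onI[OF smooth_continuous_on[OF smooth(1)]] by simp
  ultimately have "(LINT x|lebesgue. deriv \<phi> x * (primitive w x - primitive w a)) = - (LINT t|lebesgue. \<phi> t * G t)"
    using leb(2)[of "\<lambda>x. deriv \<phi> x * (primitive w x - primitive w a)"] leb(2)[of "\<lambda>t. \<phi> t * G t"]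
    by simp
  moreover have "(LINT t|lebesgue. \<phi> t * G t) = (LINT t|lebesgue. \<phi> t * w t)"
  proof (rule integral_cong_AE)
    show "(\<lambda>t. \<phi> t * G t) \<in> borel_measurable lebesgue"
      by (intro measurable_completion borel_measurable_times phi_meas G_meas)
    show "(\<lambda>t. \<phi> t * w t) \<in> borel_measurable lebesgue"
      using integrable_test_scaleR[OF phi w] by (simp add: borel_measurable_integrable)
    show "AE t in lebesgue. \<phi> t * G t = \<phi> t * w t"
      using ae by eventually_elim (use phi0 in \<open>auto simp: G_def indicator_def\<close>)
  qed
  moreover have "(LINT x|lebesgue. deriv \<phi> x * (primitive w x - primitive w a))
      = (LINT x|lebesgue. deriv \<phi> x * primitive w x) - (LINT x|lebesgue. deriv \<phi> x) * primitive w a"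
    using integrable_test_scaleR[OF test_function_deriv[OF phi] L1_loc_continuous[OF continuous_on_primitive[OF w]]]
      \<open>integrable lebesgue (deriv \<phi>)\<close> by (simp add: right_diff_distrib)
  moreover have "(LINT x|lebesgue. deriv \<phi> x) = 0"
    using test_function_integral[OF test_function_deriv[OF phi], of a b] D0 ab
    by (simp add: integral_deriv_smooth[OF smooth(1)])
  ultimately show ?thesis by simp
qed

text \<open>By the integration by parts above, \<open>v - primitive w\<close> annihilates all
  derivatives of test functions, hence is constant. In particular \<open>v\<close> has a continuous
  representative.\<close>

lemma has_weak_deriv_AE_primitive:
  fixes v w :: "real \<Rightarrow> real"
  assumes vw: "has_weak_deriv v w"
  shows "\<exists>d. AE x in lebesgue. v x = d + primitive w x"
proof -
  have L: "v \<in> L1_loc" "w \<in> L1_loc" "primitive w \<in> L1_loc"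
    using vw by (auto simp: has_weak_deriv_def intro: L1_loc_continuous continuous_on_primitive)
  have "\<exists>d. AE x in lebesgue. v x - primitive w x = d"
  proof (rule L1_loc_AE_const[OF L1_loc_diff[OF L(1,3)]])
    fix \<phi> :: "real \<Rightarrow> real" assume phi: "test_function \<phi>"
    have "(LINT x|lebesgue. deriv \<phi> x * v x) = - (LINT x|lebesgue. \<phi> x * w x)"
      using vw phi by (simp add: has_weak_deriv_def)
    then show "(LINT x|lebesgue. deriv \<phi> x * (v x - primitive w x)) = 0"
      using integrable_test_scaleR[OF test_function_deriv[OF phi] L(1)]
        integrable_test_scaleR[OF test_function_deriv[OF phi] L(3)]
        integral_primitive_mult_deriv[OF L(2) phi]
      by (simp add: right_diff_distrib)
  qed
  then obtain d where "AE x in lebesgue. v x - primitive w x = d" by blast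
  then have "AE x in lebesgue. v x = d + primitive w x"
    by eventually_elim simp
  then show ?thesis by blast
qed

section \<open>Regularity off the singular set\<close>

text \<open>The weak equation contains terms quadratic in the weak derivative; local square
  integrability and Cauchy-Schwarz make them locally integrable.\<close>

lemma L2_loc_inner_mult:
  fixes p :: "real \<Rightarrow> 'a::euclidean_space"
  assumes p: "p \<in> L2_loc"
  shows "(\<lambda>x. (p x \<bullet> a) * (p x \<bullet> b)) \<in> L1_loc"
  unfolding L1_loc_def
proof (intro CollectI conjI allI impI)
  have "p \<in> borel_measurable lebesgue" using p by (simp add: L2_loc_def)
  then show meas: "(\<lambda>x. (p x \<bullet> a) * (p x \<bullet> b)) \<in> borel_measurable lebesgue" by simp
  fix K :: "real set" assume K: "compact K"
  have Kl: "K \<in> sets lebesgue"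
    using borel_compact[OF K] by (intro sets_completionI_sets) simp
  have "set_integrable lebesgue K (\<lambda>x. (norm a * norm b) *\<^sub>R (norm (p x))\<^sup>2)"
    using p K by (simp add: L2_loc_def)
  then show "set_integrable lebesgue K (\<lambda>x. (p x \<bullet> a) * (p x \<bullet> b))"
  proof (rule set_integrable_bound)
    show "set_borel_measurable lebesgue K (\<lambda>x. (p x \<bullet> a) * (p x \<bullet> b))"
      unfolding set_borel_measurable_def by (intro borel_measurable_scaleR borel_measurable_indicator meas Kl)
    have "norm ((y \<bullet> a) * (y \<bullet> b)) \<le> norm ((norm a * norm b) *\<^sub>R (norm y)\<^sup>2)" for y
      using mult_mono[OF Cauchy_Schwarz_ineq2[of y a] Cauchy_Schwarz_ineq2[of y b]]
      by (simp add: abs_mult power2_eq_square mult_ac)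
    then show "AE x in lebesgue. x \<in> K \<longrightarrow>
        norm ((p x \<bullet> a) * (p x \<bullet> b)) \<le> norm ((norm a * norm b) *\<^sub>R (norm (p x))\<^sup>2)"
      by simp
  qed
qed

section \<open>The weak equation in components\<close>

lemma energy_space_weak_deriv:
  assumes "u \<in> energy_space"
  shows "has_weak_deriv u (wderiv u)" "continuous_on UNIV u" "wderiv u \<in> L2_loc"
proof -
  show "continuous_on UNIV u" "wderiv u \<in> L2_loc"
    using assms by (simp_all add: energy_space_def H1_loc_def)
  have "\<exists>w. has_weak_deriv u w"
    using assms by (simp add: energy_space_def H1_loc_def)
  then show "has_weak_deriv u (wderiv u)" unfolding wderiv_def by (rule someI_ex)
qed

text \<open>Test the equation with \<open>\<psi> x *\<^sub>R e\<close>. The terms with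
  \<open>deriv \<psi>\<close> collect to the \<open>e\<close>-component of the flux
  \<open>p - 2 \<kappa> (u \<bullet> p) u\<close>, those with \<open>\<psi>\<close> to its weak
  derivative up to sign.\<close>

lemma weak_solution_TW_weak_deriv:
  fixes u :: "real \<Rightarrow> complex" and e :: complex
  defines "p \<equiv> wderiv u"
  assumes sol: "weak_solution_TW c \<kappa> u"
  shows "has_weak_deriv (\<lambda>x. p x \<bullet> e - 2 * \<kappa> * (u x \<bullet> p x) * (u x \<bullet> e))
    (\<lambda>x. - ((\<i> * of_real c * p x + u x * of_real (1 - (cmod (u x))\<^sup>2)) \<bullet> e
      + 2 * \<kappa> * (u x \<bullet> p x) * (p x \<bullet> e)))"
    (is "has_weak_deriv ?v (\<lambda>x. - ?g x)")
proof -
  define F where "F x = (\<i> * of_real c * p x + u x * of_real (1 - (cmod (u x))\<^sup>2)) \<bullet> e" for x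
  have "u \<in> energy_space" using sol by (simp add: weak_solution_TW_def)
  note E = energy_space_weak_deriv[OF this, folded p_def]
  have contu: "continuous_on UNIV (\<lambda>x. Re (u x))" "continuous_on UNIV (\<lambda>x. Im (u x))"
    "continuous_on UNIV (\<lambda>x. u x \<bullet> e)" "continuous_on UNIV (\<lambda>x. 1 - (cmod (u x))\<^sup>2)"
    by (intro continuous_intros E(2))+
  have p: "(\<lambda>x. p x \<bullet> f) \<in> L1_loc" for f
    using E(1) L1_loc_inner by (auto simp: has_weak_deriv_def)
  have inner_split: "y \<bullet> z = Re y * (z \<bullet> 1) + Im y * (z \<bullet> \<i>)" for y z :: complex
    by (simp add: inner_complex_def)
  \<comment> \<open>The adjoint of multiplication by \<open>\<i>\<close> is multiplication by
    \<open>- \<i>\<close>; moving it to \<open>e\<close> leaves only components of \<open>p\<close>,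
    which are known to lie in \<open>L1_loc\<close>.\<close>
  have Fe: "F x = c * (p x \<bullet> (- \<i> * e)) + (1 - (cmod (u x))\<^sup>2) * (u x \<bullet> e)" for x
    by (simp add: F_def inner_complex_def algebra_simps)
  have up: "(\<lambda>x. u x \<bullet> p x) \<in> L1_loc"
    unfolding inner_split[of "u _"] by (intro L1_loc_add L1_loc_mult_continuous contu p)
  have upu: "(\<lambda>x. (u x \<bullet> e) * (u x \<bullet> p x)) \<in> L1_loc"
    by (intro L1_loc_mult_continuous contu up)
  have FL: "F \<in> L1_loc"
    unfolding Fe by (intro L1_loc_add L1_loc_mult_continuous L1_loc_continuous
        continuous_on_const continuous_on_mult contu p)
  have "(\<lambda>x. Re (u x) * ((p x \<bullet> 1) * (p x \<bullet> e)) + Im (u x) * ((p x \<bullet> \<i>) * (p x \<bullet> e))) \<in> L1_loc"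
    by (intro L1_loc_add L1_loc_mult_continuous contu L2_loc_inner_mult E(3))
  also have "(\<lambda>x. Re (u x) * ((p x \<bullet> 1) * (p x \<bullet> e)) + Im (u x) * ((p x \<bullet> \<i>) * (p x \<bullet> e)))
      = (\<lambda>x. (u x \<bullet> p x) * (p x \<bullet> e))"
    unfolding inner_split[of "u _" "p _"] by (simp add: algebra_simps)
  finally have upp: "(\<lambda>x. (u x \<bullet> p x) * (p x \<bullet> e)) \<in> L1_loc" .
  have gL: "?g \<in> L1_loc"
    using L1_loc_add[OF FL L1_loc_mult_continuous[OF continuous_on_const upp, of "2 * \<kappa>"]]
    by (simp add: F_def mult.assoc)
  have vL: "?v \<in> L1_loc"
    using L1_loc_diff[OF p L1_loc_mult_continuous[OF continuous_on_const upu, of "2 * \<kappa>"]]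
    by (simp add: mult_ac)
  show ?thesis
    unfolding has_weak_deriv_def
  proof (intro conjI allI impI vL)
    show "(\<lambda>x. - ?g x) \<in> L1_loc"
      using L1_loc_mult_continuous[OF continuous_on_const gL, of "-1"] by simp
    fix \<psi> :: "real \<Rightarrow> real" assume psi: "test_function \<psi>"
    define \<phi> where "\<phi> x = \<psi> x *\<^sub>R e" for x
    have "smooth \<phi>" unfolding \<phi>_def by (rule smooth_scaleR_const[OF test_function_smooth[OF psi]])
    moreover obtain a b where "\<forall>x. x \<notin> {a..b} \<longrightarrow> \<psi> x = 0" using test_functionE[OF psi] by metis
    ultimately have phi: "test_function \<phi>"
      by (intro test_functionI[of _ a b]) (simp_all add: \<phi>_def)
    have dphi: "vector_derivative \<phi> (at x) = deriv \<psi> x *\<^sub>R e" for x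
      unfolding \<phi>_def using smooth_deriv_real(1)[OF test_function_smooth[OF psi], of x]
      by (intro vector_derivative_at has_vector_derivative_scaleR[where g' = 0, simplified])
        (auto intro: derivative_eq_intros)
    define z where "z = wderiv (\<lambda>y. u y \<bullet> \<phi> y)"
    have wd: "has_weak_deriv (\<lambda>y. u y \<bullet> \<phi> y) (\<lambda>x. deriv \<psi> x * (u x \<bullet> e) + \<psi> x * (p x \<bullet> e))"
      using has_weak_deriv_test_mult[OF has_weak_deriv_inner[OF E(1), of e] psi] by (simp add: \<phi>_def)
    then have wz: "has_weak_deriv (\<lambda>y. u y \<bullet> \<phi> y) z"
      unfolding z_def wderiv_def by (rule someI[of "has_weak_deriv (\<lambda>y. u y \<bullet> \<phi> y)"])
    \<comment> \<open>The representative chosen by \<open>wderiv\<close> is replaced by the explicit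
      product rule, valid almost everywhere, which is enough under the integral.\<close>
    have z_eq: "AE x in lebesgue. z x = deriv \<psi> x * (u x \<bullet> e) + \<psi> x * (p x \<bullet> e)"
      by (rule has_weak_deriv_AE_unique[OF wz wd])
    have "(LINT x|lebesgue. (\<i> * of_real c * p x + u x * of_real (1 - (cmod (u x))\<^sup>2)) \<bullet> \<phi> x
          - p x \<bullet> vector_derivative \<phi> (at x) + 2 * \<kappa> * (u x \<bullet> p x) * z x) = 0"
      using sol phi unfolding weak_solution_TW_def p_def z_def by blast
    then have "(LINT x|lebesgue. \<psi> x * F x - deriv \<psi> x * (p x \<bullet> e) + 2 * \<kappa> * (u x \<bullet> p x) * z x) = 0"
      unfolding dphi by (simp only: \<phi>_def F_def inner_scaleR_right)
    moreover have int: "integrable lebesgue (\<lambda>x. \<psi> x * ?g x)" "integrable lebesgue (\<lambda>x. deriv \<psi> x * ?v x)"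
      using integrable_test_scaleR[OF psi gL] integrable_test_scaleR[OF test_function_deriv[OF psi] vL]
      by simp_all
    moreover have "(LINT x|lebesgue. \<psi> x * F x - deriv \<psi> x * (p x \<bullet> e) + 2 * \<kappa> * (u x \<bullet> p x) * z x)
        = (LINT x|lebesgue. \<psi> x * ?g x - deriv \<psi> x * ?v x)"
    proof (rule integral_cong_AE)
      have m: "(\<lambda>x. \<psi> x * F x) \<in> borel_measurable lebesgue"
        "(\<lambda>x. deriv \<psi> x * (p x \<bullet> e)) \<in> borel_measurable lebesgue"
        using borel_measurable_integrable[OF integrable_test_scaleR[OF psi FL]]
          borel_measurable_integrable[OF integrable_test_scaleR[OF test_function_deriv[OF psi] p[of e]]]
        by simp_all
      have m': "z \<in> borel_measurable lebesgue" "(\<lambda>x. u x \<bullet> p x) \<in> borel_measurable lebesgue"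
        using wz L1_locD(1) up by (auto simp: has_weak_deriv_def)
      show "(\<lambda>x. \<psi> x * F x - deriv \<psi> x * (p x \<bullet> e) + 2 * \<kappa> * (u x \<bullet> p x) * z x)
          \<in> borel_measurable lebesgue"
        by (intro borel_measurable_add borel_measurable_diff borel_measurable_times
            borel_measurable_const m m')
      show "(\<lambda>x. \<psi> x * ?g x - deriv \<psi> x * ?v x) \<in> borel_measurable lebesgue"
        by (rule borel_measurable_diff[OF int[THEN borel_measurable_integrable]])
      show "AE x in lebesgue. \<psi> x * F x - deriv \<psi> x * (p x \<bullet> e) + 2 * \<kappa> * (u x \<bullet> p x) * z x
          = \<psi> x * ?g x - deriv \<psi> x * ?v x"
        using z_eq
      proof eventually_elim
        case (elim x)
        show ?case unfolding elim F_def by (simp add: algebra_simps)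
      qed
    qed
    ultimately have "(LINT x|lebesgue. \<psi> x * ?g x) = (LINT x|lebesgue. deriv \<psi> x * ?v x)"
      by simp
    then show "(LINT x|lebesgue. deriv \<psi> x *\<^sub>R ?v x) = - (LINT x|lebesgue. \<psi> x *\<^sub>R - ?g x)"
      by (simp only: real_scaleR_def mult_minus_right Bochner_Integration.integral_minus minus_minus)
  qed
qed

section \<open>From the weak equation to a classical solution\<close>

lemma primitive_has_real_derivative:
  fixes w h :: "real \<Rightarrow> real"
  assumes w: "w \<in> L1_loc" and h: "continuous_on {l<..<r} h"
    and ae: "AE x in lebesgue. x \<in> {l<..<r} \<longrightarrow> w x = h x" and x: "x \<in> {l<..<r}"
  shows "(primitive w has_real_derivative h x) (at x)"
proof -
  \<comment> \<open>Midpoints give a compact neighbourhood of \<open>x\<close> inside the open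
    interval, on which \<open>h\<close> is continuous and the fundamental theorem applies.\<close>
  define a b where "a = (l + x) / 2" and "b = (x + r) / 2"
  have ab: "l < a" "a < x" "x < b" "b < r" using x by (auto simp: a_def b_def)
  have sub: "{a..b} \<subseteq> {l<..<r}" using ab by auto
  obtain N where N: "negligible N" "\<And>y. y \<notin> N \<Longrightarrow> y \<in> {l<..<r} \<longrightarrow> w y = h y"
    using ae unfolding eventually_ae_filter_negligible by auto
  have eq: "primitive w y = primitive w a + integral {a..y} h" if "y \<in> {a..b}" for y
  proof -
    have "integral {a..y} w = integral {a..y} h"
    proof (rule integral_spike[OF N(1)])
      fix x assume "x \<in> {a..y} - N"
      moreover from this have "x \<in> {a..b}" using that by auto
      ultimately show "h x = w x" using N(2) sub by auto
    qed
    then show ?thesis using primitive_eq[OF w, of a y] that by simp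
  qed
  have "((\<lambda>y. integral {a..y} h) has_vector_derivative h x) (at x within {a..b})"
    by (rule integral_has_vector_derivative[OF continuous_on_subset[OF h sub]]) (use ab in auto)
  moreover have "at x within {a..b} = at x"
    by (rule at_within_Icc_at) (use ab in auto)
  ultimately have "((\<lambda>y. integral {a..y} h) has_real_derivative h x) (at x)"
    by (simp add: has_real_derivative_iff_has_vector_derivative)
  then have "((\<lambda>y. primitive w a + integral {a..y} h) has_real_derivative 0 + h x) (at x)"
    by (rule DERIV_add[OF DERIV_const])
  then have "((\<lambda>y. primitive w a + integral {a..y} h) has_real_derivative h x) (at x)"
    by simp
  then show ?thesis
  proof (rule has_field_derivative_transform_within_open[where S = "{a<..<b}"])
    show "primitive w a + integral {a..y} h = primitive w y" if "y \<in> {a<..<b}" for y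
      by (rule eq[symmetric]) (use that in auto)
  qed (use ab in auto)
qed

lemma AE_eq_continuous:
  fixes f g :: "real \<Rightarrow> real"
  assumes "continuous_on UNIV f" "continuous_on UNIV g" "AE x in lebesgue. f x = g x"
  shows "f x = g x"
proof -
  have "closed {x. f x = g x}" by (rule closed_Collect_eq[OF assms(1,2)])
  then have "x \<in> {x. f x = g x}"
    by (rule mem_closed_if_AE_lebesgue) (use assms(3) in simp)
  then show ?thesis by simp
qed

text \<open>Bootstrap in two rounds. The flux \<open>W\<close> is a primitive, hence continuous;
  solving for the derivative makes \<open>u\<close> continuously differentiable. Then the right side
  for \<open>W'\<close> is continuous, \<open>W\<close> is differentiable, and so is
  \<open>u'\<close>. The bracket with \<open>p1\<close>, \<open>p2\<close>, \<open>q1\<close>,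
  \<open>q2\<close> is the derivative of \<open>u \<bullet> u'\<close>, that is \<open>- 1/2\<close>
  times the second derivative of \<open>eta u\<close>.\<close>

lemma weak_solution_TW_classical:
  fixes u :: "real \<Rightarrow> complex"
  defines "u1 \<equiv> \<lambda>x. Re (u x)" and "u2 \<equiv> \<lambda>x. Im (u x)"
  assumes sol: "weak_solution_TW c \<kappa> u"
    and reg: "\<And>x. x \<in> {l<..<r} \<Longrightarrow> 2 * \<kappa> * (cmod (u x))\<^sup>2 \<noteq> 1"
  shows "\<exists>p1 p2 q1 q2. \<forall>x\<in>{l<..<r}.
    (u1 has_real_derivative p1 x) (at x) \<and> (u2 has_real_derivative p2 x) (at x) \<and>
    (p1 has_real_derivative q1 x) (at x) \<and> (p2 has_real_derivative q2 x) (at x) \<and>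
    q1 x - 2 * \<kappa> * ((p1 x)\<^sup>2 + (p2 x)\<^sup>2 + u1 x * q1 x + u2 x * q2 x) * u1 x
      - c * p2 x + (1 - (u1 x)\<^sup>2 - (u2 x)\<^sup>2) * u1 x = 0 \<and>
    q2 x - 2 * \<kappa> * ((p1 x)\<^sup>2 + (p2 x)\<^sup>2 + u1 x * q1 x + u2 x * q2 x) * u2 x
      + c * p1 x + (1 - (u1 x)\<^sup>2 - (u2 x)\<^sup>2) * u2 x = 0"
proof -
  define w1 w2 where "w1 = (\<lambda>x. Re (wderiv u x))" and "w2 = (\<lambda>x. Im (wderiv u x))"
  define U where "U x = 1 - (u1 x)\<^sup>2 - (u2 x)\<^sup>2" for x
  have U: "1 - (cmod (u x))\<^sup>2 = U x" for x
    by (simp add: U_def u1_def u2_def cmod_power2)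
  have "u \<in> energy_space" using sol by (simp add: weak_solution_TW_def)
  note E = energy_space_weak_deriv[OF this]
  have cont: "continuous_on A u1" "continuous_on A u2" for A
    unfolding u1_def u2_def by (intro continuous_intros continuous_on_subset[OF E(2)] subset_UNIV)+
  \<comment> \<open>The right side for \<open>W'\<close> takes the derivative of \<open>u\<close> as
    an argument, so that the weak derivative can be exchanged for its continuous version
    later.\<close>
  define G1 G2 :: "real \<Rightarrow> real \<Rightarrow> real \<Rightarrow> real" where
    "G1 p q x = - (- c * q + u1 x * U x + 2 * \<kappa> * (u1 x * p + u2 x * q) * p)" and
    "G2 p q x = - (c * p + u2 x * U x + 2 * \<kappa> * (u1 x * p + u2 x * q) * q)" for p q x
  have wd: "has_weak_deriv u1 w1" "has_weak_deriv u2 w2"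
    using has_weak_deriv_inner[OF E(1), of 1] has_weak_deriv_inner[OF E(1), of \<i>]
    by (simp_all add: u1_def u2_def w1_def w2_def inner_complex_def)
  have wW: "has_weak_deriv (\<lambda>x. w1 x - 2 * \<kappa> * (u1 x * w1 x + u2 x * w2 x) * u1 x) (\<lambda>x. G1 (w1 x) (w2 x) x)"
    "has_weak_deriv (\<lambda>x. w2 x - 2 * \<kappa> * (u1 x * w1 x + u2 x * w2 x) * u2 x) (\<lambda>x. G2 (w1 x) (w2 x) x)"
    using weak_solution_TW_weak_deriv[OF sol, of 1] weak_solution_TW_weak_deriv[OF sol, of \<i>]
    unfolding U by (simp_all add: u1_def u2_def w1_def w2_def inner_complex_def G1_def G2_def)
  obtain d1 d2 where d: "AE x in lebesgue. w1 x - 2 * \<kappa> * (u1 x * w1 x + u2 x * w2 x) * u1 x = d1 + primitive (\<lambda>x. G1 (w1 x) (w2 x) x) x"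
    "AE x in lebesgue. w2 x - 2 * \<kappa> * (u1 x * w1 x + u2 x * w2 x) * u2 x = d2 + primitive (\<lambda>x. G2 (w1 x) (w2 x) x) x"
    using wW[THEN has_weak_deriv_AE_primitive] by blast
  \<comment> \<open>\<open>W\<close> is the image of \<open>u'\<close> under \<open>v \<mapsto> v - 2 \<kappa> (u \<bullet> v) u\<close>, whose determinant is \<open>1 - 2 \<kappa> \<bar>u\<bar>\<^sup>2\<close>.\<close>
  define W1 W2 where "W1 x = d1 + primitive (\<lambda>x. G1 (w1 x) (w2 x) x) x"
    and "W2 x = d2 + primitive (\<lambda>x. G2 (w1 x) (w2 x) x) x" for x
  have GL: "(\<lambda>x. G1 (w1 x) (w2 x) x) \<in> L1_loc" "(\<lambda>x. G2 (w1 x) (w2 x) x) \<in> L1_loc" "w1 \<in> L1_loc" "w2 \<in> L1_loc"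
    using wW wd by (simp_all add: has_weak_deriv_def)
  have contW: "continuous_on A W1" "continuous_on A W2" for A
    unfolding W1_def W2_def
    by (intro continuous_intros continuous_on_subset[OF continuous_on_primitive] GL subset_UNIV)+
  define S where "S x = 1 - 2 * \<kappa> * ((u1 x)\<^sup>2 + (u2 x)\<^sup>2)" for x
  have S: "S x \<noteq> 0" if "x \<in> {l<..<r}" for x
    using reg[OF that] by (simp add: S_def u1_def u2_def cmod_power2)
  \<comment> \<open>The Sherman-Morrison inverse of the rank-one perturbation of the identity; its
    denominator \<open>S\<close> is the determinant.\<close>
  define p1 p2 where "p1 x = W1 x + 2 * \<kappa> * (u1 x * W1 x + u2 x * W2 x) * u1 x / S x"
    and "p2 x = W2 x + 2 * \<kappa> * (u1 x * W1 x + u2 x * W2 x) * u2 x / S x" for x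
  have contp: "continuous_on {l<..<r} p1" "continuous_on {l<..<r} p2"
    unfolding p1_def p2_def using S
    by (auto intro!: continuous_intros cont contW simp: S_def)
  \<comment> \<open>Pairing the linear system with \<open>u\<close> gives
    \<open>u \<bullet> W = S (u \<bullet> v)\<close>, which determines the one unknown
    scalar.\<close>
  have solve: "x1 = X1 + 2 * \<kappa> * (a * X1 + b * X2) * a / s \<and> x2 = X2 + 2 * \<kappa> * (a * X1 + b * X2) * b / s"
    if "x1 - 2 * \<kappa> * (a * x1 + b * x2) * a = X1" "x2 - 2 * \<kappa> * (a * x1 + b * x2) * b = X2"
      "s = 1 - 2 * \<kappa> * (a\<^sup>2 + b\<^sup>2)" "s \<noteq> 0" for x1 x2 X1 X2 a b s :: real
  proof -
    have "a * X1 + b * X2 = (a * x1 + b * x2) * s"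
      unfolding that(1,2)[symmetric] that(3) by (simp add: power2_eq_square algebra_simps)
    then have "(a * X1 + b * X2) / s = a * x1 + b * x2" using that(4) by simp
    then have "2 * \<kappa> * (a * X1 + b * X2) * t / s = 2 * \<kappa> * (a * x1 + b * x2) * t" for t
      by (metis times_divide_eq_left times_divide_eq_right)
    then show ?thesis using that(1,2) by (metis add.commute add_diff_cancel_left' diff_add_cancel)
  qed
  \<comment> \<open>The converse substitution holds at every point of the interval, not just almost
    everywhere, and can therefore be differentiated.\<close>
  have inv: "W1 x = p1 x - 2 * \<kappa> * (u1 x * p1 x + u2 x * p2 x) * u1 x
      \<and> W2 x = p2 x - 2 * \<kappa> * (u1 x * p1 x + u2 x * p2 x) * u2 x" if "x \<in> {l<..<r}" for x
  proof -
    define k where "k = (u1 x * W1 x + u2 x * W2 x) / S x"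
    have k: "u1 x * W1 x + u2 x * W2 x = k * S x" using S[OF that] by (simp add: k_def)
    have p: "p1 x = W1 x + 2 * \<kappa> * k * u1 x" "p2 x = W2 x + 2 * \<kappa> * k * u2 x"
      by (simp_all add: p1_def p2_def k_def)
    have "u1 x * p1 x + u2 x * p2 x = (u1 x * W1 x + u2 x * W2 x) + 2 * \<kappa> * k * ((u1 x)\<^sup>2 + (u2 x)\<^sup>2)"
      unfolding p by (simp add: power2_eq_square algebra_simps)
    also have "\<dots> = k" unfolding k by (simp add: S_def algebra_simps)
    finally show ?thesis unfolding p by simp
  qed
  have ae: "AE x in lebesgue. x \<in> {l<..<r} \<longrightarrow> w1 x = p1 x \<and> w2 x = p2 x"
    using d
  proof eventually_elim
    case (elim x)
    show ?case
    proof
      assume "x \<in> {l<..<r}"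
      then show "w1 x = p1 x \<and> w2 x = p2 x"
        unfolding p1_def p2_def
        by (intro solve) (use elim S in \<open>simp_all add: W1_def W2_def S_def\<close>)
    qed
  qed
  have du: "(u1 has_real_derivative p1 x) (at x)" "(u2 has_real_derivative p2 x) (at x)"
    if x: "x \<in> {l<..<r}" for x
  proof -
    obtain e1 e2 where e: "AE x in lebesgue. u1 x = e1 + primitive w1 x"
      "AE x in lebesgue. u2 x = e2 + primitive w2 x"
      using wd[THEN has_weak_deriv_AE_primitive] by blast
    have c: "continuous_on UNIV (\<lambda>x. e1 + primitive w1 x)" "continuous_on UNIV (\<lambda>x. e2 + primitive w2 x)"
      by (intro continuous_intros continuous_on_primitive GL)+
    \<comment> \<open>Both sides are continuous, so equality almost everywhere is equality
      everywhere.\<close>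
    have eq: "u1 = (\<lambda>x. e1 + primitive w1 x)" "u2 = (\<lambda>x. e2 + primitive w2 x)"
      by (rule ext, rule AE_eq_continuous[OF cont(1) c(1) e(1)])
        (rule ext, rule AE_eq_continuous[OF cont(2) c(2) e(2)])
    have "(primitive w1 has_real_derivative p1 x) (at x)" "(primitive w2 has_real_derivative p2 x) (at x)"
      by (rule primitive_has_real_derivative[OF GL(3) contp(1) _ x]
          primitive_has_real_derivative[OF GL(4) contp(2) _ x], use ae in \<open>auto elim: eventually_mono\<close>)+
    then show "(u1 has_real_derivative p1 x) (at x)" "(u2 has_real_derivative p2 x) (at x)"
      unfolding eq by (auto intro!: derivative_eq_intros)
  qed
  have dW: "(W1 has_real_derivative G1 (p1 x) (p2 x) x) (at x)" "(W2 has_real_derivative G2 (p1 x) (p2 x) x) (at x)"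
    if x: "x \<in> {l<..<r}" for x
  proof -
    have contG: "continuous_on {l<..<r} (\<lambda>x. G1 (p1 x) (p2 x) x)" "continuous_on {l<..<r} (\<lambda>x. G2 (p1 x) (p2 x) x)"
      unfolding G1_def G2_def U_def by (intro continuous_intros cont contp)+
    have "AE x in lebesgue. x \<in> {l<..<r} \<longrightarrow> G1 (w1 x) (w2 x) x = G1 (p1 x) (p2 x) x"
      "AE x in lebesgue. x \<in> {l<..<r} \<longrightarrow> G2 (w1 x) (w2 x) x = G2 (p1 x) (p2 x) x"
      using ae by (auto elim!: eventually_mono)
    then have "(primitive (\<lambda>x. G1 (w1 x) (w2 x) x) has_real_derivative G1 (p1 x) (p2 x) x) (at x)"
      "(primitive (\<lambda>x. G2 (w1 x) (w2 x) x) has_real_derivative G2 (p1 x) (p2 x) x) (at x)"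
      using primitive_has_real_derivative[OF GL(1) contG(1) _ x] primitive_has_real_derivative[OF GL(2) contG(2) _ x]
      by auto
    then show "(W1 has_real_derivative G1 (p1 x) (p2 x) x) (at x)" "(W2 has_real_derivative G2 (p1 x) (p2 x) x) (at x)"
      unfolding W1_def W2_def by (auto intro!: derivative_eq_intros)
  qed
  \<comment> \<open>\<open>p1\<close> and \<open>p2\<close> are rational expressions in
    \<open>u\<close> and \<open>W\<close>, both differentiable by now, with the nonzero denominator
    \<open>S\<close>.\<close>
  have dp: "(p1 has_real_derivative deriv p1 x) (at x)" "(p2 has_real_derivative deriv p2 x) (at x)"
    if x: "x \<in> {l<..<r}" for x
  proof -
    have D: "u1 differentiable (at x)" "u2 differentiable (at x)" "W1 differentiable (at x)" "W2 differentiable (at x)"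
      using du[OF x] dW[OF x] unfolding real_differentiable_def by blast+
    have "p1 differentiable (at x)" "p2 differentiable (at x)"
      unfolding p1_def p2_def using S[OF x] unfolding S_def
      by (intro differentiable_add differentiable_divide differentiable_mult differentiable_const
          differentiable_diff differentiable_power D; simp)+
    then show "(p1 has_real_derivative deriv p1 x) (at x)" "(p2 has_real_derivative deriv p2 x) (at x)"
      by (simp_all add: DERIV_deriv_iff_real_differentiable)
  qed
  show ?thesis
  proof (rule exI[of _ p1], rule exI[of _ p2], rule exI[of _ "deriv p1"], rule exI[of _ "deriv p2"], intro ballI conjI)
    fix x assume x: "x \<in> {l<..<r}"
    show "(u1 has_real_derivative p1 x) (at x)" "(u2 has_real_derivative p2 x) (at x)"
      "(p1 has_real_derivative deriv p1 x) (at x)" "(p2 has_real_derivative deriv p2 x) (at x)"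
      by (rule du[OF x] dp[OF x])+
    define K where "K = (p1 x)\<^sup>2 + (p2 x)\<^sup>2 + u1 x * deriv p1 x + u2 x * deriv p2 x"
    define m where "m = u1 x * p1 x + u2 x * p2 x"
    have m: "((\<lambda>x. u1 x * p1 x + u2 x * p2 x) has_real_derivative K) (at x)"
      using du[OF x] dp[OF x]
      by (auto intro!: derivative_eq_intros simp: K_def power2_eq_square)
    \<comment> \<open>\<open>W1\<close> is differentiated a second time, now through its expression
      in \<open>u\<close> and \<open>u'\<close>. Comparison with the derivative \<open>G1\<close> is
      the first component of the equation.\<close>
    have "(W1 has_real_derivative deriv p1 x - (2 * \<kappa> * K * u1 x + 2 * \<kappa> * m * p1 x)) (at x)"
      by (rule has_field_derivative_transform_within_open[where S = "{l<..<r}"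
            and f = "\<lambda>x. p1 x - 2 * \<kappa> * (u1 x * p1 x + u2 x * p2 x) * u1 x"])
        (use x inv DERIV_diff[OF dp(1)[OF x] DERIV_mult[OF DERIV_cmult[OF m, of "2 * \<kappa>"] du(1)[OF x]]]
          in \<open>simp_all add: m_def mult_ac\<close>)
    from DERIV_unique[OF this dW(1)[OF x]]
    show "deriv p1 x - 2 * \<kappa> * ((p1 x)\<^sup>2 + (p2 x)\<^sup>2 + u1 x * deriv p1 x + u2 x * deriv p2 x) * u1 x
      - c * p2 x + (1 - (u1 x)\<^sup>2 - (u2 x)\<^sup>2) * u1 x = 0"
      unfolding K_def[symmetric] by (simp add: G1_def m_def U_def algebra_simps)
    have "(W2 has_real_derivative deriv p2 x - (2 * \<kappa> * K * u2 x + 2 * \<kappa> * m * p2 x)) (at x)"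
      by (rule has_field_derivative_transform_within_open[where S = "{l<..<r}"
            and f = "\<lambda>x. p2 x - 2 * \<kappa> * (u1 x * p1 x + u2 x * p2 x) * u2 x"])
        (use x inv DERIV_diff[OF dp(2)[OF x] DERIV_mult[OF DERIV_cmult[OF m, of "2 * \<kappa>"] du(2)[OF x]]]
          in \<open>simp_all add: m_def mult_ac\<close>)
    from DERIV_unique[OF this dW(2)[OF x]]
    show "deriv p2 x - 2 * \<kappa> * ((p1 x)\<^sup>2 + (p2 x)\<^sup>2 + u1 x * deriv p1 x + u2 x * deriv p2 x) * u2 x
      + c * p1 x + (1 - (u1 x)\<^sup>2 - (u2 x)\<^sup>2) * u2 x = 0"
      unfolding K_def[symmetric] by (simp add: G2_def m_def U_def algebra_simps)
  qed
qed

section \<open>Reflection symmetry\<close>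

text \<open>Gronwall: the energy \<open>V = D^2 + E^2\<close> satisfies \<open>V' <= L V\<close>, so
  \<open>V\<close> times \<open>exp (- L t)\<close> is nonincreasing and starts at zero.\<close>

lemma linear_ode_zero:
  fixes D E \<alpha> \<beta> :: "real \<Rightarrow> real"
  assumes "0 \<le> T"
    and D: "\<And>t. t \<in> {0..T} \<Longrightarrow> (D has_real_derivative E t) (at t)"
    and E: "\<And>t. t \<in> {0..T} \<Longrightarrow> (E has_real_derivative \<alpha> t * E t + \<beta> t * D t) (at t)"
    and cont: "continuous_on {0..T} \<alpha>" "continuous_on {0..T} \<beta>"
    and init: "D 0 = 0" "E 0 = 0"
  shows "D T = 0"
proof -
  have "bounded (\<alpha> ` {0..T})" "bounded (\<beta> ` {0..T})"
    by (rule compact_imp_bounded[OF compact_continuous_image[OF cont(1) compact_Icc]])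
      (rule compact_imp_bounded[OF compact_continuous_image[OF cont(2) compact_Icc]])
  then obtain A B where A: "\<forall>t\<in>{0..T}. \<bar>\<alpha> t\<bar> \<le> A" and B: "\<forall>t\<in>{0..T}. \<bar>\<beta> t\<bar> \<le> B"
    by (auto simp: bounded_iff)
  \<comment> \<open>The summands bound the parts of \<open>V'\<close>: \<open>1\<close> for
    \<open>2 D E\<close>, \<open>2 A\<close> for the term with \<open>\<alpha>\<close>, and
    \<open>B\<close> for the term with \<open>\<beta>\<close>.\<close>
  define L where "L = 1 + B + 2 * A"
  define V where "V t = (D t)\<^sup>2 + (E t)\<^sup>2" for t
  define V' where "V' t = 2 * D t * E t + 2 * E t * (\<alpha> t * E t + \<beta> t * D t)" for t
  have "V T * exp (- L * T) \<le> V 0 * exp (- L * 0)"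
  proof (rule DERIV_nonpos_imp_nonincreasing[OF assms(1)])
    fix t assume "0 \<le> t" "t \<le> T"
    then have t: "t \<in> {0..T}" by simp
    have "(V has_real_derivative V' t) (at t)"
      unfolding V_def V'_def using D[OF t] E[OF t] by (auto intro!: derivative_eq_intros)
    moreover have "((\<lambda>t. exp (- L * t)) has_real_derivative exp (- L * t) * (- L)) (at t)"
      by (auto intro!: derivative_eq_intros)
    ultimately have der: "((\<lambda>t. V t * exp (- L * t)) has_real_derivative
        V' t * exp (- L * t) + exp (- L * t) * (- L) * V t) (at t)"
      by (rule DERIV_mult)
    have DE: "2 * \<bar>D t * E t\<bar> \<le> V t"
      using sum_squares_bound[of "\<bar>D t\<bar>" "\<bar>E t\<bar>"] by (simp add: V_def abs_mult)
    have AB: "\<bar>\<alpha> t\<bar> \<le> A" "\<bar>\<beta> t\<bar> \<le> B" using A B t by auto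
    have "V' t = 2 * (D t * E t) + \<alpha> t * (2 * (E t)\<^sup>2) + \<beta> t * (2 * (D t * E t))"
      by (simp add: V'_def power2_eq_square algebra_simps)
    also have "\<dots> \<le> V t + A * (2 * V t) + B * V t"
    proof (intro add_mono)
      show "2 * (D t * E t) \<le> V t" using DE by linarith
      have "\<alpha> t * (2 * (E t)\<^sup>2) \<le> A * (2 * (E t)\<^sup>2)"
        using AB(1) by (intro mult_right_mono) auto
      also have "\<dots> \<le> A * (2 * V t)"
        using AB(1) by (intro mult_left_mono) (auto simp: V_def)
      finally show "\<alpha> t * (2 * (E t)\<^sup>2) \<le> A * (2 * V t)" .
      have "\<beta> t * (2 * (D t * E t)) \<le> \<bar>\<beta> t\<bar> * \<bar>2 * (D t * E t)\<bar>"
        by (metis abs_ge_self abs_mult)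
      also have "\<dots> \<le> B * V t"
        using AB(2) DE by (intro mult_mono) auto
      finally show "\<beta> t * (2 * (D t * E t)) \<le> B * V t" .
    qed
    also have "\<dots> = L * V t" by (simp add: L_def algebra_simps)
    finally have "(V' t - L * V t) * exp (- L * t) \<le> 0"
      by (intro mult_nonpos_nonneg) auto
    then show "\<exists>y. ((\<lambda>t. V t * exp (- L * t)) has_real_derivative y) (at t) \<and> y \<le> 0"
      using der by (intro exI[of _ "V' t * exp (- L * t) + exp (- L * t) * (- L) * V t"])
        (simp add: algebra_simps)
  qed
  then have "V T \<le> 0"
    using init by (simp add: V_def mult_le_0_iff)
  then show ?thesis
    unfolding V_def by (simp add: sum_power2_le_zero_iff)
qed

text \<open>The difference of two solutions solves a linear equation whose coefficients are
  continuous on \<open>{0..t}\<close>. The interval is half-open because the leading coefficient may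
  vanish at \<open>T\<close>, where the solutions meet a singular point.\<close>

lemma quasilinear_ode_unique:
  fixes g g' g'' h h' h'' :: "real \<Rightarrow> real"
  assumes g: "\<And>t. t \<in> {0..<T} \<Longrightarrow> (g has_real_derivative g' t) (at t)"
      "\<And>t. t \<in> {0..<T} \<Longrightarrow> (g' has_real_derivative g'' t) (at t)"
      "\<And>t. t \<in> {0..<T} \<Longrightarrow> (1 - 2 * \<kappa> + 2 * \<kappa> * g t) * g'' t + \<kappa> * (g' t)\<^sup>2 + 3 * (g t)\<^sup>2 + b * g t + m = 0"
      "\<And>t. t \<in> {0..<T} \<Longrightarrow> 1 - 2 * \<kappa> + 2 * \<kappa> * g t \<noteq> 0"
    and h: "\<And>t. t \<in> {0..<T} \<Longrightarrow> (h has_real_derivative h' t) (at t)"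
      "\<And>t. t \<in> {0..<T} \<Longrightarrow> (h' has_real_derivative h'' t) (at t)"
      "\<And>t. t \<in> {0..<T} \<Longrightarrow> (1 - 2 * \<kappa> + 2 * \<kappa> * h t) * h'' t + \<kappa> * (h' t)\<^sup>2 + 3 * (h t)\<^sup>2 + b * h t + m = 0"
      "\<And>t. t \<in> {0..<T} \<Longrightarrow> 1 - 2 * \<kappa> + 2 * \<kappa> * h t \<noteq> 0"
    and init: "g 0 = h 0" "g' 0 = h' 0"
    and t: "t \<in> {0..<T}"
  shows "g t = h t"
proof -
  define S where "S x = 1 - 2 * \<kappa> + 2 * \<kappa> * x" for x
  have sub: "s \<in> {0..<T}" if "s \<in> {0..t}" for s using that t by auto
  have cont: "continuous_on {0..t} g" "continuous_on {0..t} g'" "continuous_on {0..t} h" "continuous_on {0..t} h'"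
    by (rule DERIV_continuous_on, rule has_field_derivative_at_within, rule g h, erule sub)+
  have contS: "continuous_on {0..t} (\<lambda>s. S (g s))" "continuous_on {0..t} (\<lambda>s. S (h s))"
    unfolding S_def by (intro continuous_intros cont)+
  have Sg: "S (g s) \<noteq> 0" and Sh: "S (h s) \<noteq> 0" if "s \<in> {0..t}" for s
    using g(4)[OF sub[OF that]] h(4)[OF sub[OF that]] by (simp_all add: S_def)
  have h'': "h'' s = - (\<kappa> * (h' s)\<^sup>2 + 3 * (h s)\<^sup>2 + b * h s + m) / S (h s)" if "s \<in> {0..t}" for s
    using h(3)[OF sub[OF that]] Sh[OF that] unfolding S_def[symmetric] by (simp add: field_simps)
  \<comment> \<open>Solving the equation for \<open>h''\<close> shows its continuity, which the
    coefficient \<open>\<beta>\<close> requires.\<close>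
  have "continuous_on {0..t} (\<lambda>s. - (\<kappa> * (h' s)\<^sup>2 + 3 * (h s)\<^sup>2 + b * h s + m) / S (h s))"
    by (intro continuous_intros cont contS ballI Sh)
  then have conth'': "continuous_on {0..t} h''"
    by (rule continuous_on_eq) (simp only: h'')
  \<comment> \<open>Subtract the two equations and factor the differences of squares. The leading
    coefficients differ by \<open>2 \<kappa> (g - h)\<close>, which contributes the term with
    \<open>h''\<close>.\<close>
  define \<alpha> \<beta> where "\<alpha> s = - \<kappa> * (g' s + h' s) / S (g s)"
    and "\<beta> s = - (3 * (g s + h s) + b + 2 * \<kappa> * h'' s) / S (g s)" for s
  have "g t - h t = 0"
  proof (rule linear_ode_zero[where D = "\<lambda>t. g t - h t" and E = "\<lambda>t. g' t - h' t"])
    show "0 \<le> t" using t by simp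
    show "continuous_on {0..t} \<alpha>" "continuous_on {0..t} \<beta>"
      unfolding \<alpha>_def \<beta>_def using Sg by (auto intro!: continuous_intros cont conth'' contS)
    fix s assume s: "s \<in> {0..t}"
    show "((\<lambda>t. g t - h t) has_real_derivative g' s - h' s) (at s)"
      by (intro DERIV_diff g h sub s)
    have "((\<lambda>t. g' t - h' t) has_real_derivative g'' s - h'' s) (at s)"
      by (intro DERIV_diff g h sub s)
    moreover have "g'' s - h'' s = \<alpha> s * (g' s - h' s) + \<beta> s * (g s - h s)"
    proof -
      have "S (g s) * (g'' s - h'' s) = S (g s) * g'' s - S (h s) * h'' s - 2 * \<kappa> * (g s - h s) * h'' s"
        by (simp add: S_def algebra_simps)
      also have "\<dots> = - \<kappa> * (g' s + h' s) * (g' s - h' s) - (3 * (g s + h s) + b + 2 * \<kappa> * h'' s) * (g s - h s)"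
        using g(3)[OF sub[OF s]] h(3)[OF sub[OF s]] unfolding S_def[symmetric]
        by (simp add: power2_eq_square algebra_simps)
      finally have "g'' s - h'' s = (- \<kappa> * (g' s + h' s) * (g' s - h' s)
          - (3 * (g s + h s) + b + 2 * \<kappa> * h'' s) * (g s - h s)) / S (g s)"
        using Sg[OF s] by (simp add: eq_divide_eq mult.commute)
      moreover have "(A * E - B * D) / s = A / s * E + - B / s * D" for A B D E s :: real
        by (simp add: diff_divide_distrib)
      ultimately show ?thesis by (simp only: \<alpha>_def \<beta>_def)
    qed
    ultimately show "((\<lambda>t. g' t - h' t) has_real_derivative \<alpha> s * (g' s - h' s) + \<beta> s * (g s - h s)) (at s)"
      by simp
  qed (simp_all add: init)
  then show ?thesis by simp
qed

section \<open>The scalar equation for \<open>eta\<close>\<close>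

lemma zero_derivative_const:
  fixes f :: "real \<Rightarrow> real"
  assumes "\<And>x. x \<in> {l<..<r} \<Longrightarrow> (f has_real_derivative 0) (at x)"
  shows "\<exists>k. \<forall>x\<in>{l<..<r}. f x = k"
proof (rule has_field_derivative_zero_constant[OF convex_real_interval(8)])
  fix x assume "x \<in> {l<..<r}"
  from assms[OF this] show "(f has_real_derivative 0) (at x within {l<..<r})"
    by (rule has_field_derivative_at_within)
qed

text \<open>Pairing with \<open>u\<close> leaves two quantities not expressed by \<open>eta\<close>
  alone, the angular momentum and \<open>|u'|^2\<close>; the two first integrals eliminate them. The
  integration constants enter only through \<open>m\<close>, which is the same on the whole
  interval, so both halves of a reflected interval obey one equation.\<close>

lemma eta_ode:
  assumes sol: "weak_solution_TW c \<kappa> u"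
    and reg: "\<And>x. x \<in> {l<..<r} \<Longrightarrow> 2 * \<kappa> * (cmod (u x))\<^sup>2 \<noteq> 1"
  shows "\<exists>y z m. \<forall>x\<in>{l<..<r}. (eta u has_real_derivative y x) (at x) \<and> (y has_real_derivative z x) (at x) \<and>
    (1 - 2 * \<kappa> + 2 * \<kappa> * eta u x) * z x + \<kappa> * (y x)\<^sup>2 + 3 * (eta u x)\<^sup>2 + (c\<^sup>2 - 2) * eta u x + m = 0"
proof -
  define u1 u2 where "u1 = (\<lambda>x. Re (u x))" and "u2 = (\<lambda>x. Im (u x))"
  define H where "H x = 1 - (u1 x)\<^sup>2 - (u2 x)\<^sup>2" for x
  have eta: "eta u = H"
    by (auto simp: eta_def H_def u1_def u2_def cmod_power2)
  obtain p1 p2 q1 q2 where "\<forall>x\<in>{l<..<r}.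
    (u1 has_real_derivative p1 x) (at x) \<and> (u2 has_real_derivative p2 x) (at x) \<and>
    (p1 has_real_derivative q1 x) (at x) \<and> (p2 has_real_derivative q2 x) (at x) \<and>
    q1 x - 2 * \<kappa> * ((p1 x)\<^sup>2 + (p2 x)\<^sup>2 + u1 x * q1 x + u2 x * q2 x) * u1 x
      - c * p2 x + (1 - (u1 x)\<^sup>2 - (u2 x)\<^sup>2) * u1 x = 0 \<and>
    q2 x - 2 * \<kappa> * ((p1 x)\<^sup>2 + (p2 x)\<^sup>2 + u1 x * q1 x + u2 x * q2 x) * u2 x
      + c * p1 x + (1 - (u1 x)\<^sup>2 - (u2 x)\<^sup>2) * u2 x = 0"
    using weak_solution_TW_classical[OF sol reg] unfolding u1_def u2_def by blast
  then have
    d: "\<And>x. x \<in> {l<..<r} \<Longrightarrow> (u1 has_real_derivative p1 x) (at x)"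
      "\<And>x. x \<in> {l<..<r} \<Longrightarrow> (u2 has_real_derivative p2 x) (at x)"
      "\<And>x. x \<in> {l<..<r} \<Longrightarrow> (p1 has_real_derivative q1 x) (at x)"
      "\<And>x. x \<in> {l<..<r} \<Longrightarrow> (p2 has_real_derivative q2 x) (at x)"
    and eq1: "\<And>x. x \<in> {l<..<r} \<Longrightarrow> q1 x - 2 * \<kappa> * ((p1 x)\<^sup>2 + (p2 x)\<^sup>2 + u1 x * q1 x + u2 x * q2 x) * u1 x
      - c * p2 x + (1 - (u1 x)\<^sup>2 - (u2 x)\<^sup>2) * u1 x = 0"
    and eq2: "\<And>x. x \<in> {l<..<r} \<Longrightarrow> q2 x - 2 * \<kappa> * ((p1 x)\<^sup>2 + (p2 x)\<^sup>2 + u1 x * q1 x + u2 x * q2 x) * u2 x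
      + c * p1 x + (1 - (u1 x)\<^sup>2 - (u2 x)\<^sup>2) * u2 x = 0"
    by blast+
  define y where "y x = - 2 * (u1 x * p1 x + u2 x * p2 x)" for x
  define z where "z x = - 2 * ((p1 x)\<^sup>2 + (p2 x)\<^sup>2 + u1 x * q1 x + u2 x * q2 x)" for x
  have eq1': "q1 x + \<kappa> * z x * u1 x - c * p2 x + H x * u1 x = 0" if "x \<in> {l<..<r}" for x
    using eq1[OF that] by (simp add: z_def H_def algebra_simps)
  have eq2': "q2 x + \<kappa> * z x * u2 x + c * p1 x + H x * u2 x = 0" if "x \<in> {l<..<r}" for x
    using eq2[OF that] by (simp add: z_def H_def algebra_simps)
  have dH: "(H has_real_derivative y x) (at x)" if "x \<in> {l<..<r}" for x
    unfolding H_def y_def using d[OF that] by (auto intro!: derivative_eq_intros simp: algebra_simps)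
  have dy: "(y has_real_derivative z x) (at x)" if "x \<in> {l<..<r}" for x
    unfolding y_def z_def using d[OF that]
    by (auto intro!: derivative_eq_intros simp: algebra_simps power2_eq_square)
  \<comment> \<open>The two first integrals come from pairing the equation with \<open>\<i> * u\<close> and with \<open>u'\<close>.\<close>
  have "\<exists>k. \<forall>x\<in>{l<..<r}. u1 x * p2 x - u2 x * p1 x - c * H x / 2 = k"
  proof (rule zero_derivative_const)
    fix x assume x: "x \<in> {l<..<r}"
    have "((\<lambda>x. u1 x * p2 x - u2 x * p1 x - c * H x / 2) has_real_derivative
        (p1 x * p2 x + q2 x * u1 x) - (p2 x * p1 x + q1 x * u2 x) - c * y x / 2) (at x)"
      by (intro DERIV_diff DERIV_mult DERIV_cdivide DERIV_cmult d dH x)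
    moreover have "(p1 x * p2 x + q2 x * u1 x) - (p2 x * p1 x + q1 x * u2 x) - c * y x / 2
        = u1 x * (q2 x + \<kappa> * z x * u2 x + c * p1 x + H x * u2 x) - u2 x * (q1 x + \<kappa> * z x * u1 x - c * p2 x + H x * u1 x)"
      by (simp add: y_def field_simps)
    ultimately show "((\<lambda>x. u1 x * p2 x - u2 x * p1 x - c * H x / 2) has_real_derivative 0) (at x)"
      unfolding eq1'[OF x] eq2'[OF x] by (auto intro: DERIV_cong)
  qed
  then obtain k0 where k0: "\<And>x. x \<in> {l<..<r} \<Longrightarrow> u1 x * p2 x - u2 x * p1 x = c * H x / 2 + k0"
    by (auto simp: diff_eq_eq algebra_simps)
  have "\<exists>k. \<forall>x\<in>{l<..<r}. (p1 x)\<^sup>2 + (p2 x)\<^sup>2 - (H x)\<^sup>2 / 2 - \<kappa> * (y x)\<^sup>2 / 2 = k"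
  proof (rule zero_derivative_const)
    fix x assume x: "x \<in> {l<..<r}"
    have "((\<lambda>x. (p1 x)\<^sup>2 + (p2 x)\<^sup>2 - (H x)\<^sup>2 / 2 - \<kappa> * (y x)\<^sup>2 / 2) has_real_derivative
        2 * p1 x * q1 x + 2 * p2 x * q2 x - H x * y x - \<kappa> * (y x * z x)) (at x)"
      using d[OF x] dH[OF x] dy[OF x] by (auto intro!: derivative_eq_intros simp: algebra_simps)
    moreover have "2 * p1 x * q1 x + 2 * p2 x * q2 x - H x * y x - \<kappa> * (y x * z x)
        = 2 * p1 x * (q1 x + \<kappa> * z x * u1 x - c * p2 x + H x * u1 x) + 2 * p2 x * (q2 x + \<kappa> * z x * u2 x + c * p1 x + H x * u2 x)"
      by (simp add: y_def algebra_simps)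
    ultimately show "((\<lambda>x. (p1 x)\<^sup>2 + (p2 x)\<^sup>2 - (H x)\<^sup>2 / 2 - \<kappa> * (y x)\<^sup>2 / 2) has_real_derivative 0) (at x)"
      unfolding eq1'[OF x] eq2'[OF x] by (auto intro: DERIV_cong)
  qed
  then obtain k1 where k1: "\<And>x. x \<in> {l<..<r} \<Longrightarrow> (p1 x)\<^sup>2 + (p2 x)\<^sup>2 = (H x)\<^sup>2 / 2 + \<kappa> * (y x)\<^sup>2 / 2 + k1"
    by (auto simp: diff_eq_eq algebra_simps)
  show ?thesis
    unfolding eta
  proof (intro exI ballI conjI)
    fix x assume x: "x \<in> {l<..<r}"
    show "(H has_real_derivative y x) (at x)" "(y has_real_derivative z x) (at x)"
      by (rule dH[OF x], rule dy[OF x])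
    have "u1 x * q1 x + u2 x * q2 x = - z x / 2 - ((p1 x)\<^sup>2 + (p2 x)\<^sup>2)" by (simp add: z_def field_simps)
    moreover have "(u1 x)\<^sup>2 + (u2 x)\<^sup>2 = 1 - H x" by (simp add: H_def)
    \<comment> \<open>The equation paired with \<open>u\<close>. After the substitutions,
      multiplication by \<open>-2\<close> gives the claim.\<close>
    moreover have "u1 x * (q1 x + \<kappa> * z x * u1 x - c * p2 x + H x * u1 x) + u2 x * (q2 x + \<kappa> * z x * u2 x + c * p1 x + H x * u2 x)
       = (u1 x * q1 x + u2 x * q2 x) + (\<kappa> * z x + H x) * ((u1 x)\<^sup>2 + (u2 x)\<^sup>2) - c * (u1 x * p2 x - u2 x * p1 x)"
      by (simp add: power2_eq_square algebra_simps)
    ultimately have "- z x / 2 - ((H x)\<^sup>2 / 2 + \<kappa> * (y x)\<^sup>2 / 2 + k1) + (\<kappa> * z x + H x) * (1 - H x) - c * (c * H x / 2 + k0) = 0"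
      unfolding k0[OF x] k1[OF x] eq1'[OF x] eq2'[OF x] by simp
    then show "(1 - 2 * \<kappa> + 2 * \<kappa> * H x) * z x + \<kappa> * (y x)\<^sup>2 + 3 * (H x)\<^sup>2 + (c\<^sup>2 - 2) * H x + (2 * k1 + 2 * c * k0) = 0"
      by (simp add: power2_eq_square algebra_simps)
  qed
qed

section \<open>Reflection and monotonicity\<close>

lemma continuous_on_eta: "continuous_on UNIV u \<Longrightarrow> continuous_on A (eta u)"
  unfolding eta_def by (intro continuous_intros) (auto elim: continuous_on_subset)

text \<open>The scalar equation contains the first derivative only as a square, so reflection about
  \<open>x1\<close> preserves it. At a critical point the reflected solution has the same initial
  data.\<close>

lemma eta_reflect:
  assumes sol: "weak_solution_TW c \<kappa> u"
    and reg: "\<And>x. x \<in> {x1 - T<..<x1 + T} \<Longrightarrow> 2 * \<kappa> * (cmod (u x))\<^sup>2 \<noteq> 1"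
    and crit: "(eta u has_real_derivative 0) (at x1)"
    and t: "t \<in> {0..T}" and "0 < T"
  shows "eta u (x1 + t) = eta u (x1 - t)"
proof -
  obtain y z m where ode: "\<forall>x\<in>{x1 - T<..<x1 + T}. (eta u has_real_derivative y x) (at x) \<and> (y has_real_derivative z x) (at x) \<and>
    (1 - 2 * \<kappa> + 2 * \<kappa> * eta u x) * z x + \<kappa> * (y x)\<^sup>2 + 3 * (eta u x)\<^sup>2 + (c\<^sup>2 - 2) * eta u x + m = 0"
    using eta_ode[OF sol reg] by blast
  have S: "1 - 2 * \<kappa> + 2 * \<kappa> * eta u x \<noteq> 0" if "x \<in> {x1 - T<..<x1 + T}" for x
    using reg[OF that] by (simp add: eta_def algebra_simps)
  have y0: "y x1 = 0"
  proof -
    have "x1 \<in> {x1 - T<..<x1 + T}" using \<open>0 < T\<close> by simp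
    then have "(eta u has_real_derivative y x1) (at x1)" using ode by blast
    then show ?thesis using DERIV_unique crit by blast
  qed
  have inner: "eta u (x1 + t) = eta u (x1 - t)" if "t \<in> {0..<T}" for t
  \<comment> \<open>Reflection changes the sign of the first derivative and keeps that of the
    second.\<close>
  proof (rule quasilinear_ode_unique[where g = "\<lambda>t. eta u (x1 + t)" and h = "\<lambda>t. eta u (x1 - t)"
        and g' = "\<lambda>t. y (x1 + t)" and h' = "\<lambda>t. - y (x1 - t)"
        and g'' = "\<lambda>t. z (x1 + t)" and h'' = "\<lambda>t. z (x1 - t)" and \<kappa> = \<kappa> and b = "c\<^sup>2 - 2" and m = m and T = T])
    fix s assume "s \<in> {0..<T}"
    then have s: "x1 + s \<in> {x1 - T<..<x1 + T}" "x1 - s \<in> {x1 - T<..<x1 + T}" by auto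
    have a: "((\<lambda>t. x1 + t) has_real_derivative 1) (at s)"
      by (auto intro!: derivative_eq_intros)
    have "((\<lambda>t. eta u (x1 + t)) has_real_derivative y (x1 + s) * 1) (at s)"
      "((\<lambda>t. y (x1 + t)) has_real_derivative z (x1 + s) * 1) (at s)"
      by (rule DERIV_chain2[OF _ a], use ode s(1) in blast)+
    then show "((\<lambda>t. eta u (x1 + t)) has_real_derivative y (x1 + s)) (at s)"
      "((\<lambda>t. y (x1 + t)) has_real_derivative z (x1 + s)) (at s)"
      by simp_all
    have m: "((\<lambda>t. x1 - t) has_real_derivative - 1) (at s)"
      by (auto intro!: derivative_eq_intros)
    have "((\<lambda>t. eta u (x1 - t)) has_real_derivative y (x1 - s) * - 1) (at s)"
      "((\<lambda>t. y (x1 - t)) has_real_derivative z (x1 - s) * - 1) (at s)"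
      by (rule DERIV_chain2[OF _ m], use ode s(2) in blast)+
    then show "((\<lambda>t. eta u (x1 - t)) has_real_derivative - y (x1 - s)) (at s)"
      "((\<lambda>t. - y (x1 - t)) has_real_derivative z (x1 - s)) (at s)"
      using DERIV_minus[of "\<lambda>t. y (x1 - t)" "z (x1 - s) * - 1" s] by simp_all
  qed (use ode S y0 that in auto)
  define f where "f t = eta u (x1 + t) - eta u (x1 - t)" for t
  have "u \<in> energy_space" using sol by (simp add: weak_solution_TW_def)
  then have cont: "continuous_on UNIV (eta u)"
    by (intro continuous_on_eta energy_space_weak_deriv)
  have "continuous_on (closure {0..<T}) f"
    unfolding f_def by (intro continuous_intros continuous_on_compose2[OF cont]) auto
  moreover have "f s = 0" if "s \<in> {0..<T}" for s
    unfolding f_def inner[OF that] by simp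
  ultimately have "f t = 0" if "t \<in> closure {0..<T}"
    using continuous_constant_on_closure that by metis
  moreover have "t \<in> closure {0..<T}" using t \<open>0 < T\<close> by simp
  ultimately have "f t = 0" by blast
  then show ?thesis by (simp add: f_def)
qed

text \<open>The mean value theorem provides one point with negative derivative; a change of sign
  would force a zero, since the continuous image of an interval is connected.\<close>

lemma nonvanishing_sign:
  fixes f y :: "real \<Rightarrow> real"
  assumes "a < b" and f: "continuous_on {a..b} f"
    and d: "\<And>x. x \<in> {a<..<b} \<Longrightarrow> (f has_real_derivative y x) (at x)"
    and y: "continuous_on {a<..<b} y" "\<And>x. x \<in> {a<..<b} \<Longrightarrow> y x \<noteq> 0"
    and less: "f b < f a" and x: "x \<in> {a<..<b}"
  shows "y x < 0"
proof (rule ccontr)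
  assume "\<not> y x < 0"
  obtain l z where z: "a < z" "z < b" "(f has_real_derivative l) (at z)" "f b - f a = (b - a) * l"
    using MVT[OF \<open>a < b\<close> f] d by (meson greaterThanLessThan_iff real_differentiable_def)
  have "l = y z" using DERIV_unique[OF z(3) d] z by simp
  then have "y z < 0" using z(4) less \<open>a < b\<close> by (simp add: mult_less_0_iff flip: diff_less_0_iff_less[of "f b"])
  have "connected (y ` {a<..<b})"
    by (rule connected_continuous_image[OF y(1)]) simp
  moreover have "y z \<in> y ` {a<..<b}" "y x \<in> y ` {a<..<b}" using z x by auto
  ultimately have "0 \<in> y ` {a<..<b}"
    using \<open>y z < 0\<close> \<open>\<not> y x < 0\<close> unfolding connected_iff_interval by (meson less_imp_le not_less)
  then show False using y(2) by auto
qed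

text \<open>The disjunction on the cardinality accounts for \<open>card\<close> being
  \<open>0\<close> on infinite sets. Nonemptiness of both sets is asserted because
  \<open>Sup\<close> and \<open>Inf\<close> are meaningful only then, and differentiability because
  \<open>deriv\<close> is arbitrary without it.\<close>

theorem theorem1p5:
  fixes c \<kappa> x0 a0 b0 :: real and u :: "real \<Rightarrow> complex"
  assumes "(c, \<kappa>) \<in> D_tilde \<union> C_set"
    and "u \<in> energy_space"
    and "weak_solution_TW c \<kappa> u"
    and "infinite (singular_set \<kappa> u) \<or> card (singular_set \<kappa> u) \<ge> 2"
    and "x0 \<in> regular_extrema \<kappa> u"
    and "a0 = Sup {x. x < x0 \<and> x \<in> singular_set \<kappa> u}"
    and "b0 = Inf {x. x > x0 \<and> x \<in> singular_set \<kappa> u}"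
  shows "{x. x < x0 \<and> x \<in> singular_set \<kappa> u} \<noteq> {}
    \<and> {x. x > x0 \<and> x \<in> singular_set \<kappa> u} \<noteq> {}
    \<and> a0 = 2 * x0 - b0
    \<and> (\<forall>x\<in>{a0<..<x0}. eta u x = eta u (2 * x0 - x))
    \<and> (0 < (cmod (u x0))\<^sup>2 \<and> (cmod (u x0))\<^sup>2 < 1 / (2 * \<kappa>) \<longrightarrow>
         (\<forall>x\<in>{x0<..<b0}. eta u differentiable (at x) \<and> deriv (eta u) x < 0))
    \<and> ((cmod (u x0))\<^sup>2 > 1 / (2 * \<kappa>) \<longrightarrow>
         (\<forall>x\<in>{x0<..<b0}. eta u differentiable (at x) \<and> deriv (eta u) x > 0))"
proof -
  note sol = assms(3)
  define \<Gamma> where "\<Gamma> = singular_set \<kappa> u"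
  have "\<kappa> > 0"
    using assms(1) by (auto simp: D_tilde_def D1_def D3_def B_minus_def B_plus_def C_set_def)
  then have \<Gamma>_iff: "x \<in> \<Gamma> \<longleftrightarrow> 2 * \<kappa> * (cmod (u x))\<^sup>2 = 1" for x
    by (simp add: \<Gamma>_def singular_set_def field_simps)
  have \<Gamma>_eta: "x \<in> \<Gamma> \<longleftrightarrow> eta u x = 1 - 1 / (2 * \<kappa>)" for x
    by (simp add: \<Gamma>_def singular_set_def eta_def)
  have cont: "continuous_on A (eta u)" for A
    by (intro continuous_on_eta energy_space_weak_deriv assms(2))
  have "closed {x. eta u x = 1 - 1 / (2 * \<kappa>)}"
    by (intro closed_Collect_eq cont continuous_on_const)
  moreover have "{x. eta u x = 1 - 1 / (2 * \<kappa>)} = \<Gamma>" using \<Gamma>_eta by blast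
  ultimately have closed: "closed \<Gamma>" by simp
  have "\<Gamma> \<noteq> {}" using assms(4) by (auto simp: \<Gamma>_def)
  \<comment> \<open>A nearest singular point exists since the singular set is closed. Its distance
    \<open>T\<close> yields a symmetric singularity-free interval, whichever side it lies
    on.\<close>
  obtain \<gamma> where \<gamma>: "\<gamma> \<in> \<Gamma>" "\<And>y. y \<in> \<Gamma> \<Longrightarrow> dist x0 \<gamma> \<le> dist x0 y"
    using distance_attains_inf[OF closed \<open>\<Gamma> \<noteq> {}\<close>, of x0] by metis
  have x0: "x0 \<notin> \<Gamma>" "local_extremum (eta u) x0"
    using assms(5) by (simp_all add: regular_extrema_def \<Gamma>_def)
  define T where "T = \<bar>x0 - \<gamma>\<bar>"
  have "0 < T" using \<gamma>(1) x0(1) by (auto simp: T_def)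
  have free: "x \<notin> \<Gamma>" if "x \<in> {x0 - T<..<x0 + T}" for x
    using \<gamma>(2)[of x] that by (auto simp: T_def dist_real_def)
  then have reg: "2 * \<kappa> * (cmod (u x))\<^sup>2 \<noteq> 1" if "x \<in> {x0 - T<..<x0 + T}" for x
    using that \<Gamma>_iff by blast
  obtain y z m where "\<forall>x\<in>{x0 - T<..<x0 + T}. (eta u has_real_derivative y x) (at x) \<and> (y has_real_derivative z x) (at x) \<and>
    (1 - 2 * \<kappa> + 2 * \<kappa> * eta u x) * z x + \<kappa> * (y x)\<^sup>2 + 3 * (eta u x)\<^sup>2 + (c\<^sup>2 - 2) * eta u x + m = 0"
    using eta_ode[OF sol reg] by blast
  then have y: "(eta u has_real_derivative y x) (at x)" "(y has_real_derivative z x) (at x)"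
    if "x \<in> {x0 - T<..<x0 + T}" for x
    using that by blast+
  have y_x0: "(eta u has_real_derivative y x0) (at x0)" using \<open>0 < T\<close> by (intro y) simp
  have "y x0 = 0"
    using x0(2) unfolding local_extremum_def eventually_nhds_metric
  proof (elim disjE exE conjE)
    fix d :: real
    assume "0 < d" "\<forall>x. dist x x0 < d \<longrightarrow> eta u x \<le> eta u x0"
    then show ?thesis
      by (intro DERIV_local_max[OF y_x0, of d]) (auto simp: dist_real_def abs_minus_commute)
  next
    fix d :: real
    assume "0 < d" "\<forall>x. dist x x0 < d \<longrightarrow> eta u x0 \<le> eta u x"
    then show ?thesis
      by (intro DERIV_local_min[OF y_x0, of d]) (auto simp: dist_real_def abs_minus_commute)
  qed
  then have crit: "(eta u has_real_derivative 0) (at x0)" using y_x0 by simp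
  note reflect = eta_reflect[OF sol reg crit _ \<open>0 < T\<close>]
  \<comment> \<open>Being singular is a condition on the value of \<open>eta u\<close>, so the
    reflected endpoint is singular as well.\<close>
  have "eta u (x0 + T) = eta u (x0 - T)" using reflect[of T] \<open>0 < T\<close> by simp
  moreover have "x0 + T \<in> \<Gamma> \<or> x0 - T \<in> \<Gamma>"
  proof -
    have "\<gamma> = x0 + T \<or> \<gamma> = x0 - T" by (auto simp: T_def)
    then show ?thesis using \<gamma>(1) by blast
  qed
  ultimately have ends: "x0 + T \<in> \<Gamma>" "x0 - T \<in> \<Gamma>" by (simp_all add: \<Gamma>_eta)
  have outside: "x \<le> x0 - T \<or> x0 + T \<le> x" if "x \<in> \<Gamma>" for x
    using free[of x] that by force
  have a0: "a0 = x0 - T"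
    unfolding assms(6) \<Gamma>_def[symmetric]
    by (rule cSup_eq_maximum) (use ends outside \<open>0 < T\<close> in force)+
  have b0: "b0 = x0 + T"
    unfolding assms(7) \<Gamma>_def[symmetric]
    by (rule cInf_eq_minimum) (use ends outside \<open>0 < T\<close> in force)+
  have y_nz: "y x \<noteq> 0" if x: "x \<in> {x0<..<x0 + T}" for x
  proof
    assume "y x = 0"
    \<comment> \<open>The distance from \<open>x\<close> to the right endpoint. Reflection about
      \<open>x\<close> sends that endpoint to \<open>x - R = 2 x - x0 - T\<close>, which lies
      strictly inside the singularity-free interval.\<close>
    define R where "R = x0 + T - x"
    have sub: "{x - R<..<x + R} \<subseteq> {x0 - T<..<x0 + T}" using x by (auto simp: R_def)
    have "(eta u has_real_derivative 0) (at x)" using y(1)[of x] x \<open>0 < T\<close> \<open>y x = 0\<close> by simp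
    then have "eta u (x + R) = eta u (x - R)"
      using x reg sub by (intro eta_reflect[OF sol, where T = R]) (auto simp: R_def)
    then have "x - R \<in> \<Gamma>" using ends(1) by (simp add: \<Gamma>_eta R_def)
    moreover have "x - R \<in> {x0 - T<..<x0 + T}" using x by (auto simp: R_def)
    ultimately show False using free by blast
  qed
  have dy: "(eta u has_real_derivative y x) (at x)" if "x \<in> {x0<..<x0 + T}" for x
    using that \<open>0 < T\<close> by (intro y) auto
  have conty: "continuous_on {x0<..<x0 + T} y"
    by (rule DERIV_continuous_on, rule has_field_derivative_at_within, rule y(2)) (use \<open>0 < T\<close> in auto)
  have diff: "eta u differentiable (at x)" "deriv (eta u) x = y x" if "x \<in> {x0<..<x0 + T}" for x
    using dy[OF that] by (auto simp: real_differentiable_def intro: DERIV_imp_deriv)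
  have eta_b: "eta u (x0 + T) = 1 - 1 / (2 * \<kappa>)" using ends(1) \<Gamma>_eta by blast
  \<comment> \<open>The hypothesis says that \<open>eta u\<close> is larger at \<open>x0\<close>
    than at the singular endpoint.\<close>
  have neg: "y x < 0" if "(cmod (u x0))\<^sup>2 < 1 / (2 * \<kappa>)" "x \<in> {x0<..<x0 + T}" for x
    using that(1) eta_b \<open>0 < T\<close>
    by (intro nonvanishing_sign[OF _ cont dy conty y_nz _ that(2)]) (auto simp: eta_def)
  \<comment> \<open>The inequality between the end values is reversed, so the sign lemma is applied
    to \<open>- eta u\<close>.\<close>
  have pos: "- y x < 0" if "1 / (2 * \<kappa>) < (cmod (u x0))\<^sup>2" "x \<in> {x0<..<x0 + T}" for x
  proof (rule nonvanishing_sign[where f = "\<lambda>x. - eta u x" and y = "\<lambda>x. - y x", OF _ _ _ _ _ _ that(2)])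
    show "- eta u (x0 + T) < - eta u x0" using that(1) eta_b by (simp add: eta_def)
  qed (use \<open>0 < T\<close> y_nz in \<open>auto intro!: continuous_intros cont conty DERIV_minus dy\<close>)
  show ?thesis
  proof (intro conjI ballI impI)
    show "{x. x < x0 \<and> x \<in> singular_set \<kappa> u} \<noteq> {}" "{x. x > x0 \<and> x \<in> singular_set \<kappa> u} \<noteq> {}"
      using ends \<open>0 < T\<close> unfolding \<Gamma>_def by force+
    show "a0 = 2 * x0 - b0" by (simp add: a0 b0)
    fix x assume "x \<in> {a0<..<x0}"
    then show "eta u x = eta u (2 * x0 - x)"
      using reflect[of "x0 - x"] by (simp add: a0 algebra_simps)
  next
    fix x assume "0 < (cmod (u x0))\<^sup>2 \<and> (cmod (u x0))\<^sup>2 < 1 / (2 * \<kappa>)" "x \<in> {x0<..<b0}"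
    then show "eta u differentiable (at x)" "deriv (eta u) x < 0"
      using diff neg by (simp_all add: b0)
  next
    fix x assume "1 / (2 * \<kappa>) < (cmod (u x0))\<^sup>2" "x \<in> {x0<..<b0}"
    then show "eta u differentiable (at x)" "0 < deriv (eta u) x"
      using diff pos by (simp_all add: b0)
  qed
qed

end
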